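(* Let $A:X\to Y$ be an injective bounded linear operator with non-closed range between Hilbert spaces. Let $\Psi$ be an index function that is concave and strictly increasing on $(0,\infty)$ with $\lim_{\lambda\to+0}\Psi(\lambda)=0$, $\lim_{\lambda\to\infty}\Psi(\lambda)=\infty$ and $\lim_{\lambda\to\infty}\Psi(\lambda)/\lambda=0$, and set $$\chi(\lambda):=\frac{\Psi^{-1}(\lambda)}{\lambda},\ 0<\lambda<\infty,\qquad \bar\psi(t):=\frac{1}{\sqrt{\chi(1/t)}},\ 0<t<\infty .$$ Let $G:X\to X$ be an injective bounded self-adjoint positive definite linear operator with non-closed range. Let $Af=g$, where $f=Gw$ for some $w\in X$, and let the link condition $$\operatorname{range}(G)\subseteq X_\chi=\operatorname{range}(\bar\psi(A^*A))$$ be valid. For data $g^\delta\in Y$ with $\|g-g^\delta\|\le\delta$ consider the regularised solutions $$f_\alpha:=G(GA^*AG+\alpha I)^{-1}GA^*g^\delta .$$ Then for any a priori regularisation parameter choice $\alpha=\alpha(\delta)$ with $$\underline c\,\delta^2\le\alpha(\delta)\le\overline c\,\delta^2,\qquad 0<\delta\le\delta_{max},$$ with constants $0<\underline c\le\overline c<\infty$, we have the convergence rate $$\|f-f_\alpha\|=\mathcal O\left(\delta\sqrt{\Psi(\bar K/\delta^2)}\right)\qquad\text{as }\delta\to+0$$ with some constant $\bar K>0$.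
   Context: $X$ and $Y$ are infinite dimensional separable Hilbert spaces, with norms denoted $\|\cdot\|$. An index function is a continuous function $(0,\infty)\to(0,\infty)$; $\Psi^{-1}$ is the inverse function. $X_\chi$ is the space with index $\chi$ of the variable Hilbert scale generated by $T=(A^*A)^{-1}$: the closure (completion) of the domain of the quadratic form $\|h\|_\chi^2=(h,\chi(T)h)$, with norm $\|\cdot\|_\chi$. If $A:X\to Y$ is injective, bounded and linear with non-closed range, $\Psi$ is a concave and strictly increasing index function with $\lim_{\lambda\to+0}\Psi(\lambda)=0$, $\lim_{\lambda\to\infty}\Psi(\lambda)=\infty$ and $\lim_{\lambda\to\infty}\Psi(\lambda)/\lambda=0$, and $\chi(\lambda)=\Psi^{-1}(\lambda)/\lambda$, $\bar\psi(t)=1/\sqrt{\chi(1/t)}$, then $X_\chi=\operatorname{range}(\bar\psi(A^*A))$. Functions of $T$ and $A^*A$ are defined by the spectral calculus. $\delta_{max}>0$ is a fixed maximal noise level. *)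

theory Defs
  imports "HOL-Analysis.Analysis" "HOL-Library.Landau_Symbols"
begin

text \<open>
  Hilbert spaces are types of sort \<open>{real_inner, polish_space}\<close>, i.e. complete separable inner
  product spaces over the reals.  A complex Hilbert space with the real part of its inner product
  is one of them, with the same norm, adjoints, self-adjointness, positivity and spectral
  measures, so real scalars lose no generality here.
\<close>

definition index_function :: "(real \<Rightarrow> real) \<Rightarrow> bool" where
  "index_function \<Psi> \<longleftrightarrow> continuous_on {0<..} \<Psi> \<and> (\<forall>r>0. \<Psi> r > 0)"

text \<open>
  Only arguments in \<open>{0<..}\<close> matter for \<open>chi\<close> and \<open>psibar\<close>: the spectral measures of
  \<open>A\<^sup>* A\<close> and of its inverse are carried by \<open>{0<..}\<close>, since \<open>A\<close> is injective.
\<close>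

definition chi :: "(real \<Rightarrow> real) \<Rightarrow> real \<Rightarrow> real" where
  "chi \<Psi> r = (if 0 < r then the_inv_into {0<..} \<Psi> r / r else 0)"

definition psibar :: "(real \<Rightarrow> real) \<Rightarrow> real \<Rightarrow> real" where
  "psibar \<Psi> t = (if 0 < t then 1 / sqrt (chi \<Psi> (1 / t)) else 0)"


section \<open>Spectral calculus\<close>

definition proj_measure :: "(real set \<Rightarrow> 'a::real_inner \<Rightarrow> 'a) \<Rightarrow> bool" where
  "proj_measure E \<longleftrightarrow>
     (\<forall>B\<in>sets borel. bounded_linear (E B) \<and> (\<forall>x y. E B x \<bullet> y = x \<bullet> E B y)) \<and>
     (\<forall>B\<in>sets borel. \<forall>C\<in>sets borel. E (B \<inter> C) = E B \<circ> E C) \<and>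
     E UNIV = id \<and>
     (\<forall>F x. range F \<subseteq> sets borel \<longrightarrow> disjoint_family F \<longrightarrow>
        (\<lambda>n::nat. E (F n) x) sums E (\<Union>n. F n) x)"

definition scalar_measure :: "(real set \<Rightarrow> 'a::real_inner \<Rightarrow> 'a) \<Rightarrow> 'a \<Rightarrow> real measure" where
  "scalar_measure E x = measure_of UNIV (sets borel) (\<lambda>B. ennreal (E B x \<bullet> x))"

text \<open>
  Possibly unbounded operators are represented by their graphs.  The graph of
  \<open>\<integral>\<phi> dE\<close> has the domain \<open>{x. \<integral>\<phi>\<^sup>2 d(E x, x) < \<infinity>}\<close>, and the operator is given weakly
  by \<open>(y, z) = \<integral>\<phi> d(E x, z)\<close>, where the signed measure \<open>(E x, z)\<close> is written by polarisation.
  Testing with \<open>z\<close> in the domain suffices to determine \<open>y\<close> because the domain is dense.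
\<close>

definition spectral_dom :: "(real set \<Rightarrow> 'a::real_inner \<Rightarrow> 'a) \<Rightarrow> (real \<Rightarrow> real) \<Rightarrow> 'a set" where
  "spectral_dom E \<phi> = {x. integrable (scalar_measure E x) (\<lambda>t. (\<phi> t)\<^sup>2)}"

definition spectral_integral ::
    "(real set \<Rightarrow> 'a::real_inner \<Rightarrow> 'a) \<Rightarrow> (real \<Rightarrow> real) \<Rightarrow> ('a \<times> 'a) set" where
  "spectral_integral E \<phi> =
     {(x, y). x \<in> spectral_dom E \<phi> \<and>
        (\<forall>z\<in>spectral_dom E \<phi>.
           y \<bullet> z = ((\<integral>t. \<phi> t \<partial>scalar_measure E (x + z)) -
                    (\<integral>t. \<phi> t \<partial>scalar_measure E (x - z))) / 4)}"

definition spectral_resolution ::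
    "('a::real_inner \<times> 'a) set \<Rightarrow> (real set \<Rightarrow> 'a \<Rightarrow> 'a) \<Rightarrow> bool" where
  "spectral_resolution S E \<longleftrightarrow> proj_measure E \<and> S = spectral_integral E (\<lambda>t. t)"

text \<open>
  The graph of \<open>\<phi>(S)\<close> for a self-adjoint \<open>S\<close>; by the spectral theorem \<open>E\<close> exists and is
  unique on Borel sets.
\<close>

definition fun_calc :: "('a::real_inner \<times> 'a) set \<Rightarrow> (real \<Rightarrow> real) \<Rightarrow> ('a \<times> 'a) set" where
  "fun_calc S \<phi> = {(x, y). \<exists>E. spectral_resolution S E \<and> (x, y) \<in> spectral_integral E \<phi>}"


section \<open>Variable Hilbert scales\<close>

definition normal_op :: "('a::real_inner \<Rightarrow> 'b::real_inner) \<Rightarrow> ('a \<times> 'a) set" where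
  "normal_op A = {(x, y). y = adjoint A (A x)}"

text \<open>
  The closure of the quadratic form \<open>\<parallel>h\<parallel>\<^sup>2 = (h, \<phi>(T) h)\<close>: all limits in the ambient space of
  sequences \<open>s\<close> in the domain of \<open>\<phi>(T)\<close> that are Cauchy for this norm; \<open>y n\<close> is
  \<open>\<phi>(T) (s n)\<close>.  When \<open>\<phi>\<close> is bounded away from zero on the spectrum of \<open>T\<close>, which is
  the case for \<open>chi \<Psi>\<close> and \<open>T = (A\<^sup>* A)\<^sup>-\<^sup>1\<close>, every such Cauchy sequence converges in the
  ambient space and this set is the completion.
\<close>

definition scale_space :: "('a::real_inner \<times> 'a) set \<Rightarrow> (real \<Rightarrow> real) \<Rightarrow> 'a set" where
  "scale_space T \<phi> =
     {h. \<exists>s y. (\<forall>n. (s n, y n) \<in> fun_calc T \<phi>) \<and> s \<longlonglongrightarrow> h \<and>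
        (\<forall>e>0. \<exists>N. \<forall>m\<ge>N. \<forall>n\<ge>N. sqrt ((s m - s n) \<bullet> (y m - y n)) < e)}"


section \<open>Regularisation\<close>

definition regularised ::
    "('a::real_inner \<Rightarrow> 'b::real_inner) \<Rightarrow> ('a \<Rightarrow> 'a) \<Rightarrow> real \<Rightarrow> 'b \<Rightarrow> 'a" where
  "regularised A G a d =
     G (inv (\<lambda>x. G (adjoint A (A (G x))) + a *\<^sub>R x) (G (adjoint A d)))"

end

theory Submission
  imports Defs
begin

text \<open>
  No spectral theorem is needed for existence: the link condition makes the scale space nonempty,
  so a resolution \<open>E\<close> of \<open>T = (A\<^sup>* A)\<^sup>-\<^sup>1\<close> exists, and its image under \<open>t \<mapsto> 1/t\<close> resolves
  \<open>A\<^sup>* A\<close>.  Uniqueness holds because the range of the spectral projection of \<open>S = A\<^sup>* A\<close> for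
  \<open>[-a,a]\<close> is \<open>{x. \<forall>n. \<parallel>S\<^sup>n x\<parallel> \<le> a\<^sup>n \<parallel>x\<parallel>}\<close>.  Both descriptions of \<open>X\<^sub>\<chi>\<close> are then the domain of
  \<open>\<surd>\<chi>(T)\<close>.

  For the rate, put \<open>e = w - w\<^sub>\<alpha>\<close> and \<open>h = G e = f - f\<^sub>\<alpha>\<close>.  Testing the normal equation with \<open>e\<close>
  gives \<open>\<parallel>A h\<parallel>\<^sup>2 + \<alpha> \<parallel>e\<parallel>\<^sup>2 \<le> \<delta>\<^sup>2 + \<alpha> \<parallel>w\<parallel>\<^sup>2\<close>, so that \<open>\<parallel>A h\<parallel> = O(\<delta>)\<close> and \<open>\<parallel>e\<parallel> = O(1)\<close>, and
  uniform boundedness turns the latter into \<open>\<parallel>h\<parallel>\<^sub>\<chi> = O(1)\<close>.  Concavity and \<open>\<Psi> \<ge> 0\<close> give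
  \<open>\<Psi>(u) \<le> \<Psi>(s) (1 + u/s)\<close>; with \<open>u = \<Psi>\<^sup>-\<^sup>1(\<lambda>)\<close> this reads \<open>1 \<le> \<Psi>(s) (1/\<lambda> + \<chi>(\<lambda>)/s)\<close>.  Integrating
  against the spectral measure of \<open>h\<close> yields \<open>\<parallel>h\<parallel>\<^sup>2 \<le> \<Psi>(s) (\<parallel>A h\<parallel>\<^sup>2 + \<parallel>h\<parallel>\<^sub>\<chi>\<^sup>2 / s)\<close>, and
  \<open>s = 1/\<delta>\<^sup>2\<close> is the claim.
\<close>

section \<open>Riesz representation, adjoints, coercive operators and uniform boundedness\<close>

section \<open>Hilbert spaces\<close>

text \<open>The functional \<open>J\<close> is bounded below and its minimiser represents
  \<open>f\<close>: by the parallelogram identity minimising sequences are Cauchy, and the first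
  variation at the minimiser vanishes.\<close>

lemma riesz_representation:
  fixes f :: "'a::{real_inner, complete_space} \<Rightarrow> real"
  assumes f: "bounded_linear f"
  shows "\<exists>y. \<forall>z. f z = y \<bullet> z"
proof -
  interpret f: bounded_linear f by fact
  define J where "J z = (z \<bullet> z) / 2 - f z" for z
  obtain c where c: "\<And>z. norm (f z) \<le> norm z * c" "0 \<le> c"
    using f.nonneg_bounded by blast
  have lower: "J z \<ge> - (c\<^sup>2 / 2)" for z
  proof -
    have "0 \<le> (norm z - c)\<^sup>2" by simp
    then have "norm z * c \<le> (norm z)\<^sup>2 / 2 + c\<^sup>2 / 2"
      by (simp add: power2_diff)
    with c(1)[of z] show ?thesis
      by (simp add: J_def power2_norm_eq_inner abs_le_iff)
  qed
  define m where "m = (INF z. J z)"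
  have bdd: "bdd_below (range J)"
    using lower by (auto intro!: bdd_belowI[where m = "- (c\<^sup>2 / 2)"])
  have m_le: "m \<le> J z" for z
    unfolding m_def using bdd by (simp add: cINF_lower)
  have "\<exists>z. J z < m + 1 / real (Suc n)" for n
    using cINF_less_iff[of UNIV J "m + 1 / real (Suc n)"] bdd by (auto simp: m_def)
  then obtain s where s: "\<And>n. J (s n) < m + 1 / real (Suc n)"
    by metis
  \<comment> \<open>Parallelogram identity for \<open>J\<close>; the midpoint cannot go below
    \<open>m\<close>, so near-minimisers lie close together.\<close>
  have half: "(dist x y)\<^sup>2 \<le> 4 * (J x + J y - 2 * m)" for x y
  proof -
    have "J ((1/2) *\<^sub>R (x + y)) = (J x + J y) / 2 - (dist x y)\<^sup>2 / 8"
      by (simp add: J_def f.scaleR f.add dist_norm power2_norm_eq_inner algebra_simps inner_commute, simp add: field_simps)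
    with m_le[of "(1/2) *\<^sub>R (x + y)"] show ?thesis by (simp add: field_simps)
  qed
  have "Cauchy s"
  proof (rule metric_CauchyI)
    fix e :: real assume e: "e > 0"
    obtain N where N: "inverse (real (Suc N)) < e\<^sup>2 / 8"
      using reals_Archimedean[of "e\<^sup>2 / 8"] e by auto
    have "dist (s k) (s l) < e" if "k \<ge> N" "l \<ge> N" for k l
    proof -
      have *: "J (s n) - m < e\<^sup>2 / 8" if "n \<ge> N" for n
      proof -
        have "1 / real (Suc n) \<le> inverse (real (Suc N))"
          using that by (simp add: field_simps)
        with s[of n] N show ?thesis by linarith
      qed
      have "(dist (s k) (s l))\<^sup>2 < e\<^sup>2"
        using half[of "s k" "s l"] *[OF that(1)] *[OF that(2)] by (simp add: field_simps)
      then show ?thesis using e by (simp add: power_less_imp_less_base)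
    qed
    then show "\<exists>M. \<forall>m\<ge>M. \<forall>n\<ge>M. dist (s m) (s n) < e" by blast
  qed
  then obtain y where y: "s \<longlonglongrightarrow> y"
    using Cauchy_convergent convergent_def by blast
  have "(\<lambda>n. J (s n)) \<longlonglongrightarrow> J y"
    unfolding J_def by (intro tendsto_intros y f.tendsto) simp
  moreover have "(\<lambda>n. J (s n)) \<longlonglongrightarrow> m"
  proof (rule tendsto_sandwich[OF _ _ tendsto_const])
    show "\<forall>\<^sub>F n in sequentially. J (s n) \<le> m + 1 / real (Suc n)"
      using s by (simp add: less_imp_le)
    show "(\<lambda>n. m + 1 / real (Suc n)) \<longlonglongrightarrow> m"
      using tendsto_add[OF tendsto_const[of m] LIMSEQ_inverse_real_of_nat] by (simp add: inverse_eq_divide)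
  qed (use m_le in auto)
  ultimately have Jy: "J y = m" by (rule LIMSEQ_unique)
  have "f z = y \<bullet> z" for z
  proof (cases "z = 0")
    case False
    define d where "d = y \<bullet> z - f z"
    \<comment> \<open>This \<open>t\<close> minimises
      \<open>t * d + t * t * (z \<bullet> z) / 2\<close>, where \<open>d\<close> is the defect of
      the representation at \<open>z\<close>.\<close>
    define t where "t = - d / (z \<bullet> z)"
    have "J y \<le> J (y + t *\<^sub>R z)" using m_le Jy by simp
    moreover have "J (y + t *\<^sub>R z) = J y + (t * d + t * t * (z \<bullet> z) / 2)"
      by (simp add: J_def d_def f.scaleR f.add algebra_simps inner_commute add_divide_distrib)
    moreover have "t * d + t * t * (z \<bullet> z) / 2 = - (d * d) / (2 * (z \<bullet> z))"
      using False by (simp add: t_def field_simps)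
    ultimately have "d * d / (2 * (z \<bullet> z)) \<le> 0" by simp
    then have "d * d \<le> 0" using False inner_gt_zero_iff[of z] by (auto simp: divide_le_0_iff simp del: inner_gt_zero_iff)
    then have "d = 0" by (metis mult_eq_0_iff not_square_less_zero order_le_less)
    then show ?thesis by (simp add: d_def)
  qed (simp add: f.zero)
  then show ?thesis by blast
qed

text \<open>\<open>adjoint\<close> is a choice operator, so its defining property requires that an
  adjoint exists; Riesz representation of \<open>\<lambda>x. A x \<bullet> y\<close> supplies its
  value at each \<open>y\<close>.\<close>

lemma adjoint_inner:
  fixes A :: "'a::{real_inner, complete_space} \<Rightarrow> 'b::real_inner"
  assumes "bounded_linear A"
  shows "A x \<bullet> y = x \<bullet> adjoint A y"
proof -
  have "\<exists>v. \<forall>x. A x \<bullet> y = v \<bullet> x" for y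
    using riesz_representation[OF bounded_linear_compose[OF bounded_linear_inner_left[of y] assms]]
    by simp
  then obtain f' where "\<forall>x y. A x \<bullet> y = x \<bullet> f' y" by (metis inner_commute)
  then show ?thesis
    using adjoint_unique by blast
qed

text \<open>The square norm of \<open>adjoint A x\<close> equals
  \<open>A (adjoint A x) \<bullet> x\<close>; Cauchy--Schwarz leaves one factor of that norm on the
  right, which cancels.\<close>

lemma bounded_linear_adjoint:
  fixes A :: "'a::{real_inner, complete_space} \<Rightarrow> 'b::real_inner"
  assumes A: "bounded_linear A"
  shows "bounded_linear (adjoint A)"
proof -
  obtain c where c: "\<And>z. norm (A z) \<le> norm z * c" "0 \<le> c"
    using bounded_linear.nonneg_bounded[OF A] by blast
  show ?thesis
  proof (rule bounded_linear_intro[where K = c])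
    fix x y :: 'b and r :: real
    show "adjoint A (x + y) = adjoint A x + adjoint A y"
      by (rule vector_eq_ldot[THEN iffD1], simp add: adjoint_inner[OF A, symmetric] inner_add_right)
    show "adjoint A (r *\<^sub>R x) = r *\<^sub>R adjoint A x"
      by (rule vector_eq_ldot[THEN iffD1], simp add: adjoint_inner[OF A, symmetric])
    have "(norm (adjoint A x))\<^sup>2 = A (adjoint A x) \<bullet> x"
      by (simp add: adjoint_inner[OF A] power2_norm_eq_inner)
    also have "\<dots> \<le> norm (A (adjoint A x)) * norm x" by (rule norm_cauchy_schwarz)
    also have "\<dots> \<le> norm (adjoint A x) * c * norm x" by (intro mult_right_mono c) auto
    finally have "norm (adjoint A x) * norm (adjoint A x) \<le> norm (adjoint A x) * (norm x * c)"
      by (simp add: power2_eq_square mult_ac)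
    then show "norm (adjoint A x) \<le> norm x * c"
      using c(2) by (cases "norm (adjoint A x) = 0") auto
  qed
qed

text \<open>The Lax--Milgram argument: for small \<open>\<tau>\<close> the map \<open>x \<mapsto> x - \<tau> (L x - b)\<close> is a contraction.\<close>

lemma coercive_imp_bij:
  fixes L :: "'a::{real_inner, complete_space} \<Rightarrow> 'a"
  assumes L: "bounded_linear L" and a: "a > 0" and coercive: "\<And>x. L x \<bullet> x \<ge> a * (norm x)\<^sup>2"
  shows "bij L"
proof (rule bijI)
  interpret L: bounded_linear L by fact
  show "inj L"
  proof (rule injI)
    fix x y assume "L x = L y"
    then have "a * (norm (x - y))\<^sup>2 \<le> 0" using coercive[of "x - y"] by (simp add: L.diff)
    then show "x = y" using a by (simp add: mult_le_0_iff)
  qed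
  obtain k where k: "\<And>z. norm (L z) \<le> norm z * k" "0 < k"
    using L.pos_bounded by blast
  \<comment> \<open>The maximum ensures \<open>a \<le> K\<close>, so
    \<open>1 - a\<^sup>2 / K\<^sup>2\<close> is nonnegative; \<open>\<tau> = a / K\<^sup>2\<close>
    minimises \<open>1 - 2 * \<tau> * a + \<tau>\<^sup>2 * K\<^sup>2\<close>.\<close>
  define K where "K = max k a"
  have K: "norm (L z) \<le> norm z * K" "K \<ge> a" "K > 0" for z
    using k order_trans[OF k(1)[of z] mult_left_mono[of k K "norm z"]] by (auto simp: K_def)
  define \<tau> where "\<tau> = a / K\<^sup>2"
  have contr: "(norm (x - \<tau> *\<^sub>R L x))\<^sup>2 \<le> (1 - a\<^sup>2 / K\<^sup>2) * (norm x)\<^sup>2" for x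
  proof -
    have "(norm (L x))\<^sup>2 \<le> (norm x * K)\<^sup>2" using K by (intro power_mono) auto
    then have 1: "\<tau>\<^sup>2 * (norm (L x))\<^sup>2 \<le> \<tau>\<^sup>2 * (norm x * K)\<^sup>2" by (rule mult_left_mono) simp
    have 2: "2 * \<tau> * (a * (norm x)\<^sup>2) \<le> 2 * \<tau> * (L x \<bullet> x)"
      using a K by (intro mult_left_mono coercive) (auto simp: \<tau>_def)
    have "(norm (x - \<tau> *\<^sub>R L x))\<^sup>2 = (norm x)\<^sup>2 - 2 * \<tau> * (L x \<bullet> x) + \<tau>\<^sup>2 * (norm (L x))\<^sup>2"
      unfolding power2_norm_eq_inner
      by (simp add: algebra_simps inner_commute power2_eq_square)
    also have "\<dots> \<le> (norm x)\<^sup>2 - 2 * \<tau> * (a * (norm x)\<^sup>2) + \<tau>\<^sup>2 * (norm x * K)\<^sup>2"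
      using 1 2 by linarith
    also have "\<dots> = (1 - a\<^sup>2 / K\<^sup>2) * (norm x)\<^sup>2"
      using K by (simp add: \<tau>_def field_simps power2_eq_square)
    finally show ?thesis .
  qed
  have "a\<^sup>2 \<le> K\<^sup>2" using a K by (intro power_mono) auto
  then have q: "0 \<le> 1 - a\<^sup>2 / K\<^sup>2" "1 - a\<^sup>2 / K\<^sup>2 < 1" using a K by (auto simp: field_simps)
  define q where "q = sqrt (1 - a\<^sup>2 / K\<^sup>2)"
  show "surj L"
  proof (subst surj_def, intro allI)
    fix b
    have "\<exists>!x. x - \<tau> *\<^sub>R (L x - b) = x"
    proof (rule banach_fix_type)
      show "0 \<le> q" "q < 1" using q by (auto simp: q_def)
      show "\<forall>x y. dist (x - \<tau> *\<^sub>R (L x - b)) (y - \<tau> *\<^sub>R (L y - b)) \<le> q * dist x y"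
      proof (intro allI)
        fix x y
        have "x - \<tau> *\<^sub>R (L x - b) - (y - \<tau> *\<^sub>R (L y - b)) = (x - y) - \<tau> *\<^sub>R L (x - y)"
          by (simp add: L.diff algebra_simps)
        then have "dist (x - \<tau> *\<^sub>R (L x - b)) (y - \<tau> *\<^sub>R (L y - b)) = norm ((x - y) - \<tau> *\<^sub>R L (x - y))"
          by (simp only: dist_norm)
        also have "\<dots> \<le> sqrt ((1 - a\<^sup>2 / K\<^sup>2) * (norm (x - y))\<^sup>2)"
          by (rule real_le_rsqrt[OF contr])
        finally show "dist (x - \<tau> *\<^sub>R (L x - b)) (y - \<tau> *\<^sub>R (L y - b)) \<le> q * dist x y"
          by (simp add: q_def real_sqrt_mult dist_norm)
      qed
    qed
    moreover have "\<tau> \<noteq> 0" using a K by (simp add: \<tau>_def)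
    ultimately show "\<exists>x. b = L x" by (metis diff_eq_eq add_cancel_left_right eq_iff_diff_eq_0 scaleR_eq_0_iff)
  qed
qed

text \<open>Baire's theorem for the closed sets \<open>S N\<close>, which cover the space: one of
  them contains a ball, and linearity carries the bound from there to all vectors.\<close>

theorem uniform_boundedness:
  fixes T :: "nat \<Rightarrow> 'a::{real_normed_vector, complete_space} \<Rightarrow> 'b::real_normed_vector"
  assumes T: "\<And>k. bounded_linear (T k)" and bdd: "\<And>x. \<exists>K. \<forall>k. norm (T k x) \<le> K"
  shows "\<exists>C. \<forall>k x. norm (T k x) \<le> C * norm x"
proof -
  define S where "S N = {x. \<forall>k. norm (T k x) \<le> real N}" for N
  have cl: "closed (S N)" for N
  proof -
    have "closed {x. norm (T k x) \<le> real N}" for k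
      by (intro closed_Collect_le continuous_intros linear_continuous_on T)
    moreover have "S N = (\<Inter>k. {x. norm (T k x) \<le> real N})"
      by (auto simp: S_def)
    ultimately show ?thesis by auto
  qed
  have "\<Union>(range S) = UNIV"
  proof (intro set_eqI iffI UNIV_I)
    fix x
    obtain K where K: "\<And>k. norm (T k x) \<le> K" using bdd by blast
    obtain N where "K \<le> real N" using real_arch_simple by blast
    then have "x \<in> S N" unfolding S_def using K order_trans by blast
    then show "x \<in> \<Union>(range S)" by blast
  qed
  have "\<exists>N. interior (S N) \<noteq> {}"
  proof (rule ccontr)
    assume "\<nexists>N. interior (S N) \<noteq> {}"
    then have "interior (\<Union>(range S)) = {}"
      using Met_TC.metric_Baire_category_alt[where ?'a = 'a, of "range S"] cl complete_UNIV by auto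
    with \<open>\<Union>(range S) = UNIV\<close> show False by simp
  qed
  then obtain N a r where r: "r > 0" and ball: "ball a r \<subseteq> S N"
    by (meson ex_in_conv mem_interior)
  \<comment> \<open>The ball is moved to the origin: \<open>x\<close> is a difference of two of its
    points, hence twice the bound.\<close>
  have small: "norm (T k x) \<le> 2 * real N" if "norm x < r" for k x
  proof -
    interpret bounded_linear "T k" by (rule T)
    have "a + x \<in> S N" "a \<in> S N"
      using that r by (auto intro!: subsetD[OF ball] simp: dist_norm)
    then have "norm (T k (a + x)) \<le> real N" "norm (T k a) \<le> real N"
      by (auto simp: S_def)
    moreover have "T k x = T k (a + x) - T k a" by (simp add: add)
    ultimately show ?thesis
      using norm_triangle_ineq4[of "T k (a + x)" "T k a"] by simp
  qed
  have "norm (T k x) \<le> (4 * real N / r) * norm x" for k x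
  proof (cases "x = 0")
    case True
    interpret bounded_linear "T k" by (rule T)
    show ?thesis using True zero by simp
  next
    case False
    interpret bounded_linear "T k" by (rule T)
    define c where "c = r / (2 * norm x)"
    have c: "c > 0" using False r by (simp add: c_def)
    have "norm (c *\<^sub>R x) < r" using False r c by (simp add: c_def)
    from small[OF this, of k] have "c * norm (T k x) \<le> 2 * real N" using c by (simp add: scaleR)
    then show ?thesis using False r by (simp add: c_def field_simps)
  qed
  then show ?thesis by blast
qed

section \<open>Bounded Borel functional calculus\<close>

definition bounded_borel :: "(real \<Rightarrow> real) \<Rightarrow> bool" where
  "bounded_borel f \<longleftrightarrow> f \<in> borel_measurable borel \<and> (\<exists>M. \<forall>t. \<bar>f t\<bar> \<le> M)"

lemma bounded_borelI:
  "f \<in> borel_measurable borel \<Longrightarrow> (\<And>t. \<bar>f t\<bar> \<le> M) \<Longrightarrow> bounded_borel f"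
  by (auto simp: bounded_borel_def)

lemma bounded_borel_measurable [measurable_dest]: "bounded_borel f \<Longrightarrow> f \<in> borel_measurable borel"
  by (simp add: bounded_borel_def)

lemma bounded_borelE:
  assumes "bounded_borel f"
  obtains M where "\<And>t. \<bar>f t\<bar> \<le> M" "M \<ge> 0"
proof -
  obtain M where M: "\<And>t. \<bar>f t\<bar> \<le> M" using assms by (auto simp: bounded_borel_def)
  from M[of 0] have "M \<ge> 0" by linarith
  with M show ?thesis using that by blast
qed

lemma bounded_borel_indicator: "C \<in> sets borel \<Longrightarrow> bounded_borel (indicator C)"
  by (rule bounded_borelI[where M = 1]) (auto split: split_indicator)

lemma bounded_borel_linear:
  assumes f: "bounded_borel f" and g: "bounded_borel g"
  shows "bounded_borel (\<lambda>t. a * f t + b * g t)"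
proof -
  obtain M N where M: "\<And>t. \<bar>f t\<bar> \<le> M" and N: "\<And>t. \<bar>g t\<bar> \<le> N"
    using f g by (meson bounded_borelE)
  have "\<bar>a * f t + b * g t\<bar> \<le> \<bar>a\<bar> * M + \<bar>b\<bar> * N" for t
    using abs_triangle_ineq[of "a * f t" "b * g t"] mult_left_mono[OF M[of t], of "\<bar>a\<bar>"]
      mult_left_mono[OF N[of t], of "\<bar>b\<bar>"]
    by (simp add: abs_mult)
  moreover have "(\<lambda>t. a * f t + b * g t) \<in> borel_measurable borel"
    using f g by measurable
  ultimately show ?thesis unfolding bounded_borel_def by blast
qed

lemma bounded_borel_mult:
  assumes f: "bounded_borel f" and g: "bounded_borel g"
  shows "bounded_borel (\<lambda>t. f t * g t)"
proof -
  obtain M N where M: "\<And>t. \<bar>f t\<bar> \<le> M" and N: "\<And>t. \<bar>g t\<bar> \<le> N" "M \<ge> 0"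
    using f g by (meson bounded_borelE)
  have "\<bar>f t * g t\<bar> \<le> M * N" for t
    using mult_mono[OF M[of t] N(1)[of t]] N by (simp add: abs_mult)
  moreover have "(\<lambda>t. f t * g t) \<in> borel_measurable borel"
    using f g by measurable
  ultimately show ?thesis unfolding bounded_borel_def by blast
qed

lemma bounded_borel_diff:
  "bounded_borel f \<Longrightarrow> bounded_borel g \<Longrightarrow> bounded_borel (\<lambda>t. f t - g t)"
  using bounded_borel_linear[of f g 1 "-1"] by simp

text \<open>Simple functions are combinations of indicators, and every bounded Borel function is a
  pointwise limit of uniformly bounded simple ones. The limit case is shaped for dominated
  convergence under finite measures.\<close>

lemma bounded_borel_induct [consumes 1, case_names indicator linear limit]:
  assumes f: "bounded_borel f"
    and ind: "\<And>C. C \<in> sets borel \<Longrightarrow> P (indicator C)"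
    and lin: "\<And>g h a b. bounded_borel g \<Longrightarrow> bounded_borel h \<Longrightarrow> P g \<Longrightarrow> P h \<Longrightarrow> P (\<lambda>t. a * g t + b * h t)"
    and lim: "\<And>F f M. (\<And>i. bounded_borel (F i)) \<Longrightarrow> (\<And>i. P (F i)) \<Longrightarrow> (\<And>(i::nat) t. \<bar>F i t\<bar> \<le> M) \<Longrightarrow>
      (\<And>t. (\<lambda>i. F i t) \<longlonglongrightarrow> f t) \<Longrightarrow> bounded_borel f \<Longrightarrow> P f"
  shows "P f"
proof -
  have simple: "bounded_borel s \<and> P s" if s: "simple_function borel s" for s :: "real \<Rightarrow> real"
  proof -
    have fin: "finite (range s)" and meas: "\<And>y. s -` {y} \<in> sets borel"
      using simple_functionD[OF s] by auto
    have zero: "bounded_borel (\<lambda>t. 0)" "P (\<lambda>t. 0)"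
      using bounded_borel_indicator[of "{}"] ind[of "{}"] by (simp_all add: indicator_def[abs_def])
    have "bounded_borel (\<lambda>t. \<Sum>y\<in>Y. indicator (s -` {y}) t * y) \<and>
        P (\<lambda>t. \<Sum>y\<in>Y. indicator (s -` {y}) t * y)" if "finite Y" for Y
      using that
    proof induction
      case (insert y Y)
      have b: "bounded_borel (indicator (s -` {y}))" "P (indicator (s -` {y}))"
        using meas by (auto intro: bounded_borel_indicator ind)
      have eq: "(\<lambda>t. \<Sum>z\<in>insert y Y. indicator (s -` {z}) t * z) =
          (\<lambda>t. y * indicator (s -` {y}) t + 1 * (\<Sum>z\<in>Y. indicator (s -` {z}) t * z))"
        unfolding sum.insert[OF insert.hyps] by (simp add: mult.commute)
      show ?case
        unfolding eq using insert.IH b by (intro conjI bounded_borel_linear lin) blast+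
    qed (use zero in simp)
    note sums = this[OF fin]
    have s_eq: "(\<lambda>t. \<Sum>y\<in>range s. indicator (s -` {y}) t * y) = s"
    proof
      fix t
      show "(\<Sum>y\<in>range s. indicator (s -` {y}) t * y) = s t"
        using simple_function_indicator_representation_banach[OF s, of t]
        by (simp only: space_borel UNIV_I Int_UNIV_right real_scaleR_def)
    qed
    show ?thesis using sums unfolding s_eq .
  qed
  obtain M where M: "\<And>t. \<bar>f t\<bar> \<le> M" using f by (meson bounded_borelE)
  obtain F where F: "\<And>i. simple_function borel (F i)" "\<And>t. (\<lambda>i. F i t) \<longlonglongrightarrow> f t"
      "\<And>i t. dist (F i t) 0 \<le> 2 * dist (f t) 0"
    using borel_measurable_implies_sequence_metric[OF bounded_borel_measurable[OF f], of 0] by auto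
  show ?thesis
  proof (rule lim)
    show "\<bar>F i t\<bar> \<le> 2 * M" for i t using F(3)[of i t] M[of t] by (simp add: dist_norm)
    show "bounded_borel (F i)" "P (F i)" for i using simple[OF F(1)] by blast+
  qed (rule F f)+
qed

text \<open>Values above the level are cut to 0, not clipped at \<open>n\<close>: the truncation is
  then \<open>\<phi>\<close> times an indicator, and spectral projections map truncations to
  truncations.\<close>

definition trunc :: "(real \<Rightarrow> real) \<Rightarrow> nat \<Rightarrow> real \<Rightarrow> real" where
  "trunc \<phi> n t = \<phi> t * indicator {t. \<bar>\<phi> t\<bar> \<le> real n} t"

lemma abs_trunc_le: "\<bar>trunc \<phi> n t\<bar> \<le> real n" "\<bar>trunc \<phi> n t\<bar> \<le> \<bar>\<phi> t\<bar>"
  by (auto simp: trunc_def split: split_indicator)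

lemma borel_measurable_trunc [measurable]:
  assumes [measurable]: "\<phi> \<in> borel_measurable borel"
  shows "trunc \<phi> n \<in> borel_measurable borel"
  unfolding trunc_def[abs_def] by measurable

lemma bounded_borel_trunc: "\<phi> \<in> borel_measurable borel \<Longrightarrow> bounded_borel (trunc \<phi> n)"
  by (rule bounded_borelI[OF borel_measurable_trunc abs_trunc_le(1)])

lemma eventually_trunc_eq: "\<forall>\<^sub>F n in sequentially. trunc \<phi> n t = \<phi> t"
proof -
  obtain N where "\<bar>\<phi> t\<bar> \<le> real N" using real_arch_simple by blast
  then have "trunc \<phi> n t = \<phi> t" if "n \<ge> N" for n using that by (simp add: trunc_def)
  then show ?thesis by (auto simp: eventually_sequentially)
qed

lemma trunc_tendsto: "(\<lambda>n. trunc \<phi> n t) \<longlonglongrightarrow> \<phi> t"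
  by (rule tendsto_eventually[OF eventually_trunc_eq])

lemma Collect_abs_le_borel [measurable]:
  assumes [measurable]: "\<phi> \<in> borel_measurable borel"
  shows "{t. \<bar>\<phi> t\<bar> \<le> real n} \<in> sets (borel :: real measure)"
  by measurable

text \<open>The integral of \<open>f\<close> against the signed measure \<open>(E x, z)\<close>,
  polarised as in \<open>spectral_integral\<close>. Linearity in \<open>z\<close> has to be proved,
  since scalar measures are quadratic in the vector.\<close>

definition sform :: "(real set \<Rightarrow> 'a::real_inner \<Rightarrow> 'a) \<Rightarrow> (real \<Rightarrow> real) \<Rightarrow> 'a \<Rightarrow> 'a \<Rightarrow> real" where
  "sform E f x z = ((\<integral>t. f t \<partial>scalar_measure E (x + z)) - (\<integral>t. f t \<partial>scalar_measure E (x - z))) / 4"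

definition bcalc :: "(real set \<Rightarrow> 'a::real_inner \<Rightarrow> 'a) \<Rightarrow> (real \<Rightarrow> real) \<Rightarrow> 'a \<Rightarrow> 'a" where
  "bcalc E f x = (SOME y. \<forall>z. y \<bullet> z = sform E f x z)"

section \<open>Projection-valued measures and their bounded functional calculus\<close>

locale projection_valued =
  fixes E :: "real set \<Rightarrow> 'a::{real_inner, complete_space} \<Rightarrow> 'a"
  assumes proj_measure: "proj_measure E"
begin

lemma bounded_linear_proj: "B \<in> sets borel \<Longrightarrow> bounded_linear (E B)"
  and proj_sym: "B \<in> sets borel \<Longrightarrow> E B x \<bullet> y = x \<bullet> E B y"
  and proj_Int: "B \<in> sets borel \<Longrightarrow> C \<in> sets borel \<Longrightarrow> E B (E C x) = E (B \<inter> C) x"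
  and proj_UNIV [simp]: "E UNIV x = x"
  and proj_sums: "range F \<subseteq> sets borel \<Longrightarrow> disjoint_family F \<Longrightarrow> (\<lambda>n::nat. E (F n) x) sums E (\<Union>n. F n) x"
  using proj_measure by (auto simp: proj_measure_def)

lemma proj_inner_self: "B \<in> sets borel \<Longrightarrow> E B x \<bullet> x = (norm (E B x))\<^sup>2"
  using proj_Int[of B B x] proj_sym[of B "E B x" x] by (simp add: power2_norm_eq_inner)

text \<open>The constant family of empty sets is disjoint, and a convergent series with equal terms
  has terms 0.\<close>

lemma proj_empty [simp]: "E {} x = 0"
proof -
  have "(\<lambda>n::nat. E {} x) sums E {} x"
    using proj_sums[of "\<lambda>_. {}" x] by (simp add: disjoint_family_on_def)
  then have "(\<lambda>n::nat. E {} x) \<longlonglongrightarrow> 0"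
    using summable_LIMSEQ_zero sums_summable by blast
  then show ?thesis by (simp add: LIMSEQ_const_iff)
qed

lemma norm_proj_le: "B \<in> sets borel \<Longrightarrow> norm (E B x) \<le> norm x"
proof -
  assume B: "B \<in> sets borel"
  have "norm (E B x) * norm (E B x) \<le> norm (E B x) * norm x"
    using norm_cauchy_schwarz[of "E B x" x] proj_inner_self[OF B, of x] by (simp add: power2_eq_square)
  then show ?thesis by (cases "norm (E B x) = 0") auto
qed

lemma sets_scalar_measure [simp, measurable_cong]: "sets (scalar_measure E x) = sets borel"
  and space_scalar_measure [simp]: "space (scalar_measure E x) = UNIV"
  using sets.sets_measure_of_eq[of "borel :: real measure"] sets.space_measure_of_eq[of "borel :: real measure"]
  by (simp_all add: scalar_measure_def)

lemma emeasure_scalar_measure: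
  assumes B: "B \<in> sets borel"
  shows "emeasure (scalar_measure E x) B = ennreal ((norm (E B x))\<^sup>2)"
proof -
  have "emeasure (scalar_measure E x) B = ennreal (E B x \<bullet> x)"
  proof (rule emeasure_measure_of[OF scalar_measure_def])
    show "positive (sets (scalar_measure E x)) (\<lambda>B. ennreal (E B x \<bullet> x))"
      by (simp add: positive_def)
    show "countably_additive (sets (scalar_measure E x)) (\<lambda>B. ennreal (E B x \<bullet> x))"
    proof (rule countably_additiveI)
      fix F :: "nat \<Rightarrow> real set"
      assume F: "range F \<subseteq> sets (scalar_measure E x)" "disjoint_family F"
      then have "(\<lambda>n. E (F n) x \<bullet> x) sums (E (\<Union>n. F n) x \<bullet> x)"
        by (intro bounded_linear.sums[OF bounded_linear_inner_left] proj_sums) auto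
      then show "(\<Sum>i. ennreal (E (F i) x \<bullet> x)) = ennreal (E (\<Union> (range F)) x \<bullet> x)"
        using F(1) by (intro suminf_ennreal_eq) (auto simp: proj_inner_self image_subset_iff)
    qed
  qed (use B in auto)
  with B show ?thesis by (simp add: proj_inner_self)
qed

lemma measure_scalar_measure:
  "B \<in> sets borel \<Longrightarrow> measure (scalar_measure E x) B = E B x \<bullet> x"
  by (simp add: measure_def emeasure_scalar_measure proj_inner_self)

lemma finite_measure_scalar_measure: "finite_measure (scalar_measure E x)"
  by (rule finite_measureI) (simp add: emeasure_scalar_measure)

lemma integrable_bounded_borel:
  assumes "bounded_borel f"
  shows "integrable (scalar_measure E x) f"
proof -
  interpret finite_measure "scalar_measure E x" by (rule finite_measure_scalar_measure)
  obtain M where "\<And>t. \<bar>f t\<bar> \<le> M" using assms by (meson bounded_borelE)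
  then show ?thesis
    using bounded_borel_measurable[OF assms] by (intro integrable_const_bound[where B = M]) auto
qed

lemma integral_bounded_limit:
  fixes F :: "nat \<Rightarrow> real \<Rightarrow> real"
  assumes "\<And>i. F i \<in> borel_measurable borel" "f \<in> borel_measurable borel"
    and "\<And>i t. \<bar>F i t\<bar> \<le> M" "\<And>t. (\<lambda>i. F i t) \<longlonglongrightarrow> f t"
  shows "(\<lambda>i. \<integral>t. F i t \<partial>scalar_measure E x) \<longlonglongrightarrow> (\<integral>t. f t \<partial>scalar_measure E x)"
proof -
  interpret finite_measure "scalar_measure E x" by (rule finite_measure_scalar_measure)
  show ?thesis
    by (rule integral_dominated_convergence[where w = "\<lambda>_. M"]) (use assms in auto)
qed

lemma abs_integral_bounded_le:
  assumes "\<And>t. \<bar>f t\<bar> \<le> M"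
  shows "\<bar>\<integral>t. f t \<partial>scalar_measure E x\<bar> \<le> M * (norm x)\<^sup>2"
proof (cases "integrable (scalar_measure E x) f")
  case True
  interpret finite_measure "scalar_measure E x" by (rule finite_measure_scalar_measure)
  have "\<bar>\<integral>t. f t \<partial>scalar_measure E x\<bar> \<le> (\<integral>t. \<bar>f t\<bar> \<partial>scalar_measure E x)"
    by (rule integral_abs_bound)
  also have "\<dots> \<le> (\<integral>t. M \<partial>scalar_measure E x)"
    using True assms by (intro integral_mono) auto
  also have "\<dots> = M * (norm x)\<^sup>2"
    using measure_scalar_measure[of UNIV x] by (simp add: power2_norm_eq_inner)
  finally show ?thesis .
next
  case False
  have "M \<ge> 0" using assms[of 0] by linarith
  with False show ?thesis by (simp add: not_integrable_integral_eq)
qed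

lemma sform_linear:
  assumes "bounded_borel f" "bounded_borel g"
  shows "sform E (\<lambda>t. a * f t + b * g t) x z = a * sform E f x z + b * sform E g x z"
  using assms by (simp add: sform_def integrable_bounded_borel field_simps)

lemma sform_limit:
  assumes "\<And>i. bounded_borel (F i)" "bounded_borel f"
    and "\<And>i t. \<bar>F i t\<bar> \<le> M" "\<And>t. (\<lambda>i. F i t) \<longlonglongrightarrow> f t"
  shows "(\<lambda>i. sform E (F i) x z) \<longlonglongrightarrow> sform E f x z"
  unfolding sform_def using assms
  by (intro tendsto_intros integral_bounded_limit) (auto intro: bounded_borel_measurable)

lemma sform_indicator:
  assumes C: "C \<in> sets borel"
  shows "sform E (indicator C) x z = E C x \<bullet> z"
proof -
  interpret bounded_linear "E C" by (rule bounded_linear_proj[OF C])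
  have "E C z \<bullet> x = E C x \<bullet> z" using proj_sym[OF C, of x z] by (simp add: inner_commute)
  then show ?thesis
    using C by (simp add: sform_def measure_scalar_measure add diff algebra_simps)
qed

lemma sform_self: "bounded_borel f \<Longrightarrow> sform E f x x = (\<integral>t. f t \<partial>scalar_measure E x)"
proof (induction rule: bounded_borel_induct)
  case (indicator C)
  then show ?case by (simp add: sform_indicator measure_scalar_measure)
next
  case (linear g h a b)
  then show ?case by (simp add: sform_linear integrable_bounded_borel)
next
  case (limit F f M)
  show ?case
    using LIMSEQ_unique[OF sform_limit[of F f M, OF limit.hyps(1,4,2,3), where x = x and z = x, unfolded limit.IH]
      integral_bounded_limit[of F f M, OF bounded_borel_measurable[OF limit.hyps(1)]
        bounded_borel_measurable[OF limit.hyps(4)] limit.hyps(2,3)]] .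
qed

lemma sform_commute: "bounded_borel f \<Longrightarrow> sform E f x z = sform E f z x"
proof (induction rule: bounded_borel_induct)
  case (indicator C)
  then show ?case using proj_sym[OF indicator, of x z] by (simp add: sform_indicator inner_commute)
next
  case (linear g h a b)
  then show ?case by (simp add: sform_linear)
next
  case (limit F f M)
  show ?case
    by (rule LIMSEQ_unique[OF sform_limit[of F f M, OF limit.hyps(1,4,2,3)]])
      (simp only: limit.IH, rule sform_limit[of F f M, OF limit.hyps(1,4,2,3)])
qed

text \<open>Additivity is evident for indicators, where the form is
  \<open>E C x \<bullet> z\<close>; the induction extends it to bounded Borel functions. The
  neighbouring identities follow the same scheme.\<close>

lemma sform_add_right: "bounded_borel f \<Longrightarrow> sform E f x (y + z) = sform E f x y + sform E f x z"
proof (induction rule: bounded_borel_induct)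
  case (indicator C)
  then show ?case by (simp add: sform_indicator inner_add_right)
next
  case (linear g h a b)
  then show ?case by (simp add: sform_linear algebra_simps)
next
  case (limit F f M)
  show ?case
    by (rule LIMSEQ_unique[OF sform_limit[of F f M, OF limit.hyps(1,4,2,3)]])
      (simp only: limit.IH, intro tendsto_add sform_limit[of F f M, OF limit.hyps(1,4,2,3)])
qed

lemma sform_scaleR_right: "bounded_borel f \<Longrightarrow> sform E f x (r *\<^sub>R z) = r * sform E f x z"
proof (induction rule: bounded_borel_induct)
  case (indicator C)
  then show ?case by (simp add: sform_indicator)
next
  case (linear g h a b)
  then show ?case by (simp add: sform_linear algebra_simps)
next
  case (limit F f M)
  show ?case
    by (rule LIMSEQ_unique[OF sform_limit[of F f M, OF limit.hyps(1,4,2,3)]])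
      (simp only: limit.IH, intro tendsto_mult_left sform_limit[of F f M, OF limit.hyps(1,4,2,3)])
qed

lemma sform_proj_right:
  assumes C: "C \<in> sets borel"
  shows "bounded_borel f \<Longrightarrow> sform E f x (E C z) = sform E (\<lambda>t. indicator C t * f t) x z"
proof (induction rule: bounded_borel_induct)
  case (indicator D)
  have "E D x \<bullet> E C z = E (C \<inter> D) x \<bullet> z"
    using C indicator by (simp flip: proj_sym[OF C] add: proj_Int)
  then show ?case
    using C indicator by (simp add: sform_indicator flip: indicator_inter_arith)
next
  case (linear g h a b)
  have "(\<lambda>t. indicator C t * (a * g t + b * h t)) =
      (\<lambda>t. a * (indicator C t * g t) + b * (indicator C t * h t))"
    by (simp add: algebra_simps)
  then show ?case
    using linear C by (simp add: sform_linear bounded_borel_mult bounded_borel_indicator)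
next
  case (limit F f M)
  have "(\<lambda>i. sform E (\<lambda>t. indicator C t * F i t) x z) \<longlonglongrightarrow> sform E (\<lambda>t. indicator C t * f t) x z"
  proof (rule sform_limit[where M = M])
    have "0 \<le> M" using limit.hyps(2)[of 0 0] by linarith
    then show "\<bar>indicator C t * F i t\<bar> \<le> M" for i t using limit.hyps(2)[of i t] by (auto split: split_indicator)
  qed (use limit C in \<open>auto intro!: bounded_borel_mult bounded_borel_indicator tendsto_intros\<close>)
  then show ?case
    using LIMSEQ_unique sform_limit[of F f M, OF limit.hyps(1,4,2,3), where x = x and z = "E C z", unfolded limit.IH] by blast
qed

text \<open>The parallelogram law bounds the polarised form by a quadratic expression; rescaling
  \<open>z\<close> to norm 1 makes the bound linear in \<open>z\<close>. The constant may depend on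
  \<open>x\<close>, as Riesz representation is applied for each \<open>x\<close> separately.\<close>

lemma bounded_linear_sform:
  assumes f: "bounded_borel f"
  shows "bounded_linear (sform E f x)"
proof -
  obtain M where M: "\<And>t. \<bar>f t\<bar> \<le> M" "M \<ge> 0" using f by (meson bounded_borelE)
  have bound: "\<bar>sform E f x z\<bar> \<le> M * ((norm x)\<^sup>2 + (norm z)\<^sup>2) / 2" for z
  proof -
    have "\<bar>sform E f x z\<bar> \<le> (M * (norm (x + z))\<^sup>2 + M * (norm (x - z))\<^sup>2) / 4"
      using abs_integral_bounded_le[where f = f, OF M(1), of "x + z"]
        abs_integral_bounded_le[where f = f, OF M(1), of "x - z"]
      by (simp add: sform_def)
    also have "\<dots> = M * ((norm x)\<^sup>2 + (norm z)\<^sup>2) / 2"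
      by (simp add: power2_norm_eq_inner algebra_simps)
    finally show ?thesis .
  qed
  show ?thesis
  proof (rule bounded_linear_intro[where K = "M * ((norm x)\<^sup>2 + 1) / 2"])
    show "norm (sform E f x z) \<le> norm z * (M * ((norm x)\<^sup>2 + 1) / 2)" for z
    proof (cases "z = 0")
      case True
      then show ?thesis using sform_scaleR_right[OF f, of x 0 z] by simp
    next
      case False
      have "sform E f x z = norm z * sform E f x ((1 / norm z) *\<^sub>R z)"
        using False by (simp add: sform_scaleR_right[OF f])
      with bound[of "(1 / norm z) *\<^sub>R z"] False show ?thesis
        by (simp add: abs_mult mult_left_mono)
    qed
  qed (use f in \<open>simp_all add: sform_add_right sform_scaleR_right\<close>)
qed

lemma bcalc_inner:
  assumes f: "bounded_borel f"
  shows "bcalc E f x \<bullet> z = sform E f x z"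
proof -
  obtain y where "\<forall>z. sform E f x z = y \<bullet> z"
    using riesz_representation[OF bounded_linear_sform[OF f]] by blast
  then have "\<forall>z. y \<bullet> z = sform E f x z" by simp
  then show ?thesis unfolding bcalc_def by (rule someI2) simp
qed

lemma bcalc_eqI:
  assumes "bounded_borel f" "\<And>z. sform E f x z = y \<bullet> z"
  shows "bcalc E f x = y"
  using bcalc_inner[OF assms(1)] assms(2) by (metis vector_eq_rdot)

lemma bcalc_indicator: "C \<in> sets borel \<Longrightarrow> bcalc E (indicator C) x = E C x"
  by (rule bcalc_eqI) (simp_all add: bounded_borel_indicator sform_indicator)

lemma bcalc_sym: "bounded_borel f \<Longrightarrow> bcalc E f x \<bullet> z = x \<bullet> bcalc E f z"
  by (metis bcalc_inner inner_commute sform_commute)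

lemma bcalc_linear:
  "bounded_borel f \<Longrightarrow> bounded_borel g \<Longrightarrow>
    bcalc E (\<lambda>t. a * f t + b * g t) x = a *\<^sub>R bcalc E f x + b *\<^sub>R bcalc E g x"
  by (rule bcalc_eqI) (simp_all add: bounded_borel_linear sform_linear bcalc_inner inner_add_left)

lemma bcalc_diff:
  "bounded_borel f \<Longrightarrow> bounded_borel g \<Longrightarrow>
    bcalc E (\<lambda>t. f t - g t) x = bcalc E f x - bcalc E g x"
  using bcalc_linear[of f g 1 "-1"] by simp

lemma proj_bcalc:
  assumes C: "C \<in> sets borel" and f: "bounded_borel f"
  shows "E C (bcalc E f x) = bcalc E (\<lambda>t. indicator C t * f t) x"
  using assms
  by (intro bcalc_eqI[symmetric])
    (simp_all add: bounded_borel_mult bounded_borel_indicator proj_sym[OF C] bcalc_inner sform_proj_right)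

lemma bcalc_mult:
  assumes f: "bounded_borel f" and g: "bounded_borel g"
  shows "bcalc E f (bcalc E g x) = bcalc E (\<lambda>t. f t * g t) x"
proof (rule bcalc_eqI[OF f])
  fix z
  show "sform E f (bcalc E g x) z = bcalc E (\<lambda>t. f t * g t) x \<bullet> z"
    using f
  proof (induction rule: bounded_borel_induct)
    case (indicator C)
    then show ?case using g by (simp add: sform_indicator proj_bcalc)
  next
    case (linear f1 f2 a b)
    have "(\<lambda>t. (a * f1 t + b * f2 t) * g t) = (\<lambda>t. a * (f1 t * g t) + b * (f2 t * g t))"
      by (simp add: algebra_simps)
    then show ?case
      using linear g by (simp add: sform_linear bounded_borel_mult bcalc_linear inner_add_left)
  next
    case (limit F f M)
    obtain N where N: "\<And>t. \<bar>g t\<bar> \<le> N" "N \<ge> 0" using g by (meson bounded_borelE)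
    have "(\<lambda>i. sform E (\<lambda>t. F i t * g t) x z) \<longlonglongrightarrow> sform E (\<lambda>t. f t * g t) x z"
    proof (rule sform_limit[where M = "M * N"])
      show "\<bar>F i t * g t\<bar> \<le> M * N" for i t
        using mult_mono[OF limit.hyps(2)[of i t] N(1)[of t]] limit.hyps(2)[of i t] N(2) by (auto simp: abs_mult)
    qed (use limit g in \<open>auto intro!: bounded_borel_mult tendsto_intros\<close>)
    then have "(\<lambda>i. sform E (F i) (bcalc E g x) z) \<longlonglongrightarrow> sform E (\<lambda>t. f t * g t) x z"
      using limit.hyps(1) g by (simp add: limit.IH bcalc_inner bounded_borel_mult)
    then show ?case
      using LIMSEQ_unique sform_limit[of F f M, OF limit.hyps(1,4,2,3), where x = "bcalc E g x" and z = z] limit.hyps(4) g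
      by (metis bcalc_inner bounded_borel_mult)
  qed
qed

text \<open>Symmetry and multiplicativity reduce the square norm to the form of
  \<open>f\<^sup>2\<close> at \<open>x\<close>. This isometry turns convergence of integrals into
  convergence in norm.\<close>

lemma norm_bcalc:
  assumes f: "bounded_borel f"
  shows "(norm (bcalc E f x))\<^sup>2 = (\<integral>t. (f t)\<^sup>2 \<partial>scalar_measure E x)"
proof -
  have "(norm (bcalc E f x))\<^sup>2 = bcalc E f (bcalc E f x) \<bullet> x"
    by (simp add: power2_norm_eq_inner bcalc_sym[OF f, of "bcalc E f x"])
  also have "\<dots> = sform E (\<lambda>t. f t * f t) x x"
    using f by (simp add: bcalc_mult bcalc_inner bounded_borel_mult)
  also have "\<dots> = (\<integral>t. (f t)\<^sup>2 \<partial>scalar_measure E x)"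
    using f by (simp add: sform_self bounded_borel_mult power2_eq_square)
  finally show ?thesis .
qed

lemma bounded_linear_bcalc:
  assumes f: "bounded_borel f"
  shows "bounded_linear (bcalc E f)"
proof -
  obtain M where M: "\<And>t. \<bar>f t\<bar> \<le> M" "M \<ge> 0" using f by (meson bounded_borelE)
  show ?thesis
  proof (rule bounded_linear_intro[where K = M])
    fix x y r
    show "bcalc E f (x + y) = bcalc E f x + bcalc E f y"
      by (rule vector_eq_rdot[THEN iffD1]) (simp add: bcalc_sym[OF f] inner_add_left)
    show "bcalc E f (r *\<^sub>R x) = r *\<^sub>R bcalc E f x"
      by (rule vector_eq_rdot[THEN iffD1]) (simp add: bcalc_sym[OF f])
    have "\<bar>(f t)\<^sup>2\<bar> \<le> M\<^sup>2" for t using power_mono[OF M(1)[of t], of 2] by simp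
    then have "(norm (bcalc E f x))\<^sup>2 \<le> M\<^sup>2 * (norm x)\<^sup>2"
      unfolding norm_bcalc[OF f] using abs_integral_bounded_le[of "\<lambda>t. (f t)\<^sup>2" "M\<^sup>2" x] by simp
    then show "norm (bcalc E f x) \<le> norm x * M"
      using M(2) power2_le_imp_le[of "norm (bcalc E f x)" "norm x * M"]
      by (simp add: power_mult_distrib mult.commute)
  qed
qed

lemma bcalc_limit:
  assumes F: "\<And>i. bounded_borel (F i)" and f: "bounded_borel f"
    and M: "\<And>i t. \<bar>F i t\<bar> \<le> M" and lim: "\<And>t. (\<lambda>i. F i t) \<longlonglongrightarrow> f t"
  shows "(\<lambda>i. bcalc E (F i) x) \<longlonglongrightarrow> bcalc E f x"
proof -
  have f_le: "\<bar>f t\<bar> \<le> M" for t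
    using M tendsto_rabs[OF lim[of t]] by (intro LIMSEQ_le_const2[where X = "\<lambda>i. \<bar>F i t\<bar>"]) auto
  have "\<bar>(F i t - f t)\<^sup>2\<bar> \<le> (2 * M)\<^sup>2" for i t
    using power_mono[of "\<bar>F i t - f t\<bar>" "2 * M" 2] M[of i t] f_le[of t] by simp
  then have "(\<lambda>i. \<integral>t. (F i t - f t)\<^sup>2 \<partial>scalar_measure E x) \<longlonglongrightarrow> (\<integral>t. 0 \<partial>scalar_measure E x)"
    using F f lim by (intro integral_bounded_limit) (auto intro!: tendsto_eq_intros)
  then have "(\<lambda>i. (norm (bcalc E (F i) x - bcalc E f x))\<^sup>2) \<longlonglongrightarrow> 0"
    using F f by (simp add: norm_bcalc bounded_borel_diff flip: bcalc_diff)
  then have "(\<lambda>i. norm (bcalc E (F i) x - bcalc E f x)) \<longlonglongrightarrow> 0"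
    using tendsto_real_sqrt by fastforce
  then show ?thesis by (simp add: LIM_zero_iff tendsto_norm_zero_iff)
qed

text \<open>Indicators that eventually agree at each point converge boundedly, so
  \<open>bcalc_limit\<close> applies; increasing and decreasing sequences are covered alike.\<close>

lemma proj_limit:
  assumes C: "\<And>i. C i \<in> sets borel" "D \<in> sets borel"
    and "\<And>t. \<forall>\<^sub>F i in sequentially. t \<in> C i \<longleftrightarrow> t \<in> D"
  shows "(\<lambda>i. E (C i) x) \<longlonglongrightarrow> E D x"
proof -
  have "(\<lambda>i. bcalc E (indicator (C i)) x) \<longlonglongrightarrow> bcalc E (indicator D) x"
  proof (rule bcalc_limit[where M = 1])
    show "(\<lambda>i. indicator (C i) t :: real) \<longlonglongrightarrow> indicator D t" for t
      by (rule tendsto_eventually, rule eventually_mono[OF assms(3)[of t]]) (auto split: split_indicator)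
  qed (use C in \<open>auto simp: bounded_borel_indicator split: split_indicator\<close>)
  then show ?thesis using C by (simp add: bcalc_indicator)
qed

end

section \<open>Domains, graphs, norms and inverses of operators with unbounded integrands\<close>

section \<open>Unbounded spectral integrals\<close>

lemma spectral_integral_sform:
  "(x, y) \<in> spectral_integral E \<phi> \<longleftrightarrow>
    x \<in> spectral_dom E \<phi> \<and> (\<forall>z\<in>spectral_dom E \<phi>. y \<bullet> z = sform E \<phi> x z)"
  by (simp add: spectral_integral_def sform_def)

context projection_valued
begin

lemma proj_Compl:
  assumes B: "B \<in> sets borel"
  shows "E (- B) x = x - E B x"
proof -
  have "(\<lambda>t. indicator UNIV t - indicator B t) = (indicator (- B) :: real \<Rightarrow> real)"
    by (auto split: split_indicator)
  with bcalc_diff[OF bounded_borel_indicator[of UNIV] bounded_borel_indicator[OF B], of x] show ?thesis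
    using B bcalc_indicator[of UNIV x] bcalc_indicator[of "- B" x] by (simp add: bcalc_indicator borel_comp)
qed

text \<open>The measure of the complement is the square norm of \<open>x - E B x\<close>, which is
  0. Estimates of the integrand on \<open>B\<close> thus suffice for vectors of this
  subspace.\<close>

lemma AE_scalar_measure:
  assumes "B \<in> sets borel" "E B x = x"
  shows "AE t in scalar_measure E x. t \<in> B"
proof (rule AE_I')
  show "- B \<in> null_sets (scalar_measure E x)"
    using assms by (simp add: null_sets_def emeasure_scalar_measure proj_Compl borel_comp)
qed auto

lemma integral_trunc_limit:
  assumes [measurable]: "\<phi> \<in> borel_measurable borel" and int: "integrable (scalar_measure E x) \<phi>"
  shows "(\<lambda>n. \<integral>t. trunc \<phi> n t \<partial>scalar_measure E x) \<longlonglongrightarrow> (\<integral>t. \<phi> t \<partial>scalar_measure E x)"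
  by (rule integral_dominated_convergence[where w = "\<lambda>t. \<bar>\<phi> t\<bar>"])
    (use int in \<open>auto intro!: trunc_tendsto abs_trunc_le\<close>)

lemma integral_trunc_square_limit:
  assumes [measurable]: "\<phi> \<in> borel_measurable borel"
    and int: "integrable (scalar_measure E x) (\<lambda>t. (\<phi> t)\<^sup>2)"
  shows "(\<lambda>n. \<integral>t. (trunc \<phi> n t)\<^sup>2 \<partial>scalar_measure E x) \<longlonglongrightarrow> (\<integral>t. (\<phi> t)\<^sup>2 \<partial>scalar_measure E x)"
proof (rule integral_dominated_convergence[where w = "\<lambda>t. (\<phi> t)\<^sup>2"])
  show "AE t in scalar_measure E x. norm ((trunc \<phi> n t)\<^sup>2) \<le> (\<phi> t)\<^sup>2" for n
    using abs_trunc_le(2)[of \<phi> n] by (auto simp: abs_le_square_iff)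
qed (use int in \<open>auto intro!: tendsto_intros trunc_tendsto\<close>)

text \<open>Domination of the truncations by \<open>\<phi>\<close> gives one direction, Fatou's
  lemma the other. Phrased with bounded operators, the domain is accessible to linearity and to
  uniform boundedness.\<close>

lemma spectral_dom_iff:
  assumes \<phi>[measurable]: "\<phi> \<in> borel_measurable borel"
  shows "x \<in> spectral_dom E \<phi> \<longleftrightarrow> (\<exists>K. \<forall>n. norm (bcalc E (trunc \<phi> n) x) \<le> K)"
proof
  assume "x \<in> spectral_dom E \<phi>"
  then have int: "integrable (scalar_measure E x) (\<lambda>t. (\<phi> t)\<^sup>2)" by (simp add: spectral_dom_def)
  have "norm (bcalc E (trunc \<phi> n) x) \<le> sqrt (\<integral>t. (\<phi> t)\<^sup>2 \<partial>scalar_measure E x)" for n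
  proof (rule real_le_rsqrt)
    show "(norm (bcalc E (trunc \<phi> n) x))\<^sup>2 \<le> (\<integral>t. (\<phi> t)\<^sup>2 \<partial>scalar_measure E x)"
      unfolding norm_bcalc[OF bounded_borel_trunc[OF \<phi>]]
    proof (rule integral_mono[OF _ int])
      show "integrable (scalar_measure E x) (\<lambda>t. (trunc \<phi> n t)\<^sup>2)"
        unfolding power2_eq_square by (intro integrable_bounded_borel bounded_borel_mult bounded_borel_trunc \<phi>)
      show "(trunc \<phi> n t)\<^sup>2 \<le> (\<phi> t)\<^sup>2" for t using abs_trunc_le(2)[of \<phi> n t] by (simp add: abs_le_square_iff)
    qed
  qed
  then show "\<exists>K. \<forall>n. norm (bcalc E (trunc \<phi> n) x) \<le> K" by blast
next
  assume "\<exists>K. \<forall>n. norm (bcalc E (trunc \<phi> n) x) \<le> K"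
  then obtain K where K: "\<And>n. norm (bcalc E (trunc \<phi> n) x) \<le> K" by blast
  have nn: "(\<integral>\<^sup>+t. ennreal ((trunc \<phi> n t)\<^sup>2) \<partial>scalar_measure E x) \<le> ennreal (K\<^sup>2)" for n
  proof -
    have "integrable (scalar_measure E x) (\<lambda>t. (trunc \<phi> n t)\<^sup>2)"
      unfolding power2_eq_square by (intro integrable_bounded_borel bounded_borel_mult bounded_borel_trunc \<phi>)
    then have "(\<integral>\<^sup>+t. ennreal ((trunc \<phi> n t)\<^sup>2) \<partial>scalar_measure E x) = ennreal ((norm (bcalc E (trunc \<phi> n) x))\<^sup>2)"
      by (simp add: norm_bcalc[OF bounded_borel_trunc[OF \<phi>]] nn_integral_eq_integral)
    also have "\<dots> \<le> ennreal (K\<^sup>2)" using K[of n] by (intro ennreal_leI power_mono) auto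
    finally show ?thesis .
  qed
  have "(\<integral>\<^sup>+t. ennreal ((\<phi> t)\<^sup>2) \<partial>scalar_measure E x) =
      (\<integral>\<^sup>+t. liminf (\<lambda>n. ennreal ((trunc \<phi> n t)\<^sup>2)) \<partial>scalar_measure E x)"
  proof (rule nn_integral_cong)
    fix t
    have "(\<lambda>n. ennreal ((trunc \<phi> n t)\<^sup>2)) \<longlonglongrightarrow> ennreal ((\<phi> t)\<^sup>2)"
      by (intro tendsto_intros trunc_tendsto)
    then show "ennreal ((\<phi> t)\<^sup>2) = liminf (\<lambda>n. ennreal ((trunc \<phi> n t)\<^sup>2))"
      using lim_imp_Liminf[OF trivial_limit_sequentially] by metis
  qed
  also have "\<dots> \<le> liminf (\<lambda>n. \<integral>\<^sup>+t. ennreal ((trunc \<phi> n t)\<^sup>2) \<partial>scalar_measure E x)"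
    by (rule nn_integral_liminf) measurable
  also have "\<dots> \<le> liminf (\<lambda>n::nat. ennreal (K\<^sup>2))"
    by (intro Liminf_mono always_eventually allI nn)
  also have "\<dots> = ennreal (K\<^sup>2)" by (simp add: Liminf_const)
  finally have "(\<integral>\<^sup>+t. ennreal ((\<phi> t)\<^sup>2) \<partial>scalar_measure E x) < \<infinity>"
    using ennreal_less_top le_less_trans by (metis infinity_ennreal_def)
  then show "x \<in> spectral_dom E \<phi>"
    unfolding spectral_dom_def by (intro CollectI integrableI_bounded) auto
qed

lemma spectral_dom_add:
  assumes \<phi>: "\<phi> \<in> borel_measurable borel" and "x \<in> spectral_dom E \<phi>" "z \<in> spectral_dom E \<phi>"
  shows "x + z \<in> spectral_dom E \<phi>" "x - z \<in> spectral_dom E \<phi>"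
proof -
  obtain K L where K: "\<And>n. norm (bcalc E (trunc \<phi> n) x) \<le> K" and L: "\<And>n. norm (bcalc E (trunc \<phi> n) z) \<le> L"
    using assms by (auto simp: spectral_dom_iff)
  have "norm (bcalc E (trunc \<phi> n) (x + z)) \<le> K + L" "norm (bcalc E (trunc \<phi> n) (x - z)) \<le> K + L" for n
  proof -
    interpret bounded_linear "bcalc E (trunc \<phi> n)" by (intro bounded_linear_bcalc bounded_borel_trunc \<phi>)
    show "norm (bcalc E (trunc \<phi> n) (x + z)) \<le> K + L" "norm (bcalc E (trunc \<phi> n) (x - z)) \<le> K + L"
      unfolding add diff using K[of n] L[of n] by (metis add_mono norm_triangle_le norm_triangle_le_diff)+
  qed
  then show "x + z \<in> spectral_dom E \<phi>" "x - z \<in> spectral_dom E \<phi>"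
    unfolding spectral_dom_iff[OF \<phi>] by blast+
qed

text \<open>The scalar measure of \<open>E C x\<close> is carried by \<open>C\<close>, so a bound on
  \<open>C\<close> suffices. Such vectors serve below as test vectors and approximants.\<close>

lemma proj_in_spectral_dom:
  assumes [measurable]: "\<phi> \<in> borel_measurable borel" "C \<in> sets borel" and K: "\<And>t. t \<in> C \<Longrightarrow> \<bar>\<phi> t\<bar> \<le> K"
  shows "E C x \<in> spectral_dom E \<phi>"
proof -
  have AE: "AE t in scalar_measure E (E C x). t \<in> C"
    by (rule AE_scalar_measure) (simp_all add: proj_Int)
  interpret finite_measure "scalar_measure E (E C x)" by (rule finite_measure_scalar_measure)
  have "integrable (scalar_measure E (E C x)) (\<lambda>t. (\<phi> t)\<^sup>2)"
  proof (rule integrable_const_bound[where B = "K\<^sup>2"])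
    show "AE t in scalar_measure E (E C x). norm ((\<phi> t)\<^sup>2) \<le> K\<^sup>2"
      using AE
    proof eventually_elim
      case (elim t)
      then show ?case using power_mono[OF K[OF elim], of 2] by simp
    qed
  qed simp
  then show ?thesis by (simp add: spectral_dom_def)
qed

lemma integrable_of_spectral_dom:
  assumes [measurable]: "\<phi> \<in> borel_measurable borel" and "x \<in> spectral_dom E \<phi>"
  shows "integrable (scalar_measure E x) \<phi>"
proof -
  interpret finite_measure "scalar_measure E x" by (rule finite_measure_scalar_measure)
  show ?thesis
    by (rule square_integrable_imp_integrable) (use assms in \<open>simp_all add: spectral_dom_def\<close>)
qed

lemma sform_trunc_limit:
  assumes \<phi>: "\<phi> \<in> borel_measurable borel" and x: "x \<in> spectral_dom E \<phi>" and z: "z \<in> spectral_dom E \<phi>"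
  shows "(\<lambda>n. bcalc E (trunc \<phi> n) x \<bullet> z) \<longlonglongrightarrow> sform E \<phi> x z"
  unfolding bcalc_inner[OF bounded_borel_trunc[OF \<phi>]] sform_def
  by (intro tendsto_intros integral_trunc_limit integrable_of_spectral_dom spectral_dom_add \<phi> x z) simp

lemma proj_trunc_limit:
  assumes [measurable]: "\<phi> \<in> borel_measurable borel"
  shows "(\<lambda>n. E {t. \<bar>\<phi> t\<bar> \<le> real n} y) \<longlonglongrightarrow> y"
proof -
  have "\<forall>\<^sub>F n in sequentially. \<bar>\<phi> t\<bar> \<le> real n" for t
    using filterlim_real_sequentially by (simp add: filterlim_at_top)
  then have "(\<lambda>n. E {t. \<bar>\<phi> t\<bar> \<le> real n} y) \<longlonglongrightarrow> E UNIV y"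
    by (intro proj_limit) auto
  then show ?thesis by simp
qed

lemma proj_bcalc_trunc:
  assumes \<phi>[measurable]: "\<phi> \<in> borel_measurable borel" and "n \<le> m"
  shows "E {t. \<bar>\<phi> t\<bar> \<le> real n} (bcalc E (trunc \<phi> m) x) = bcalc E (trunc \<phi> n) x"
proof -
  have "(\<lambda>t. indicator {t. \<bar>\<phi> t\<bar> \<le> real n} t * trunc \<phi> m t) = trunc \<phi> n"
    using assms(2) by (auto simp: trunc_def split: split_indicator)
  then show ?thesis by (simp add: proj_bcalc bounded_borel_trunc)
qed

text \<open>Replaces the weak definition by equations between bounded operators. Forwards, vectors
  projected to a level set are admissible test vectors; backwards, contractivity of projections
  gives the domain, and growing \<open>n\<close> the weak equation.\<close>

lemma spectral_integral_iff:
  assumes \<phi>[measurable]: "\<phi> \<in> borel_measurable borel"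
  shows "(x, y) \<in> spectral_integral E \<phi> \<longleftrightarrow>
    (\<forall>n. E {t. \<bar>\<phi> t\<bar> \<le> real n} y = bcalc E (trunc \<phi> n) x)"
proof
  assume "(x, y) \<in> spectral_integral E \<phi>"
  then have x: "x \<in> spectral_dom E \<phi>" and y: "\<And>z. z \<in> spectral_dom E \<phi> \<Longrightarrow> y \<bullet> z = sform E \<phi> x z"
    unfolding spectral_integral_sform by blast+
  show "\<forall>n. E {t. \<bar>\<phi> t\<bar> \<le> real n} y = bcalc E (trunc \<phi> n) x"
  proof (rule allI, rule vector_eq_rdot[THEN iffD1], rule allI)
    fix n z
    let ?C = "{t. \<bar>\<phi> t\<bar> \<le> real n}"
    have z: "E ?C z \<in> spectral_dom E \<phi>"
      by (rule proj_in_spectral_dom[where K = "real n"]) auto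
    \<comment> \<open>Levels above \<open>n\<close> are removed by the projection, so the sequence
      converging to the form is eventually constant.\<close>
    have "bcalc E (trunc \<phi> m) x \<bullet> E ?C z = bcalc E (trunc \<phi> n) x \<bullet> z" if "m \<ge> n" for m
      using that by (simp add: proj_bcalc_trunc flip: proj_sym)
    then have "(\<lambda>m. bcalc E (trunc \<phi> m) x \<bullet> E ?C z) \<longlonglongrightarrow> bcalc E (trunc \<phi> n) x \<bullet> z"
      by (intro tendsto_eventually) (auto simp: eventually_sequentially)
    then have "sform E \<phi> x (E ?C z) = bcalc E (trunc \<phi> n) x \<bullet> z"
      using LIMSEQ_unique sform_trunc_limit[OF \<phi> x z] by blast
    then show "E ?C y \<bullet> z = bcalc E (trunc \<phi> n) x \<bullet> z"
      using y[OF z] by (simp add: proj_sym)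
  qed
next
  assume *: "\<forall>n. E {t. \<bar>\<phi> t\<bar> \<le> real n} y = bcalc E (trunc \<phi> n) x"
  have "norm (bcalc E (trunc \<phi> n) x) \<le> norm y" for n
    using norm_proj_le[of "{t. \<bar>\<phi> t\<bar> \<le> real n}" y] *[rule_format, of n] by simp
  then have x: "x \<in> spectral_dom E \<phi>" by (auto simp: spectral_dom_iff)
  have "y \<bullet> z = sform E \<phi> x z" if z: "z \<in> spectral_dom E \<phi>" for z
  proof (rule LIMSEQ_unique)
    show "(\<lambda>n. E {t. \<bar>\<phi> t\<bar> \<le> real n} y \<bullet> z) \<longlonglongrightarrow> y \<bullet> z"
      by (intro tendsto_intros proj_trunc_limit \<phi>)
    show "(\<lambda>n. E {t. \<bar>\<phi> t\<bar> \<le> real n} y \<bullet> z) \<longlonglongrightarrow> sform E \<phi> x z"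
      using sform_trunc_limit[OF \<phi> x z] * by simp
  qed
  with x show "(x, y) \<in> spectral_integral E \<phi>"
    unfolding spectral_integral_sform by blast
qed

lemma spectral_integral_dom:
  "(x, y) \<in> spectral_integral E \<phi> \<Longrightarrow> x \<in> spectral_dom E \<phi>"
  by (simp add: spectral_integral_def)

lemma spectral_integral_unique:
  assumes "\<phi> \<in> borel_measurable borel" "(x, y) \<in> spectral_integral E \<phi>" "(x, y') \<in> spectral_integral E \<phi>"
  shows "y = y'"
  using assms LIMSEQ_unique[OF proj_trunc_limit[of \<phi> y]] proj_trunc_limit[of \<phi> y']
  by (simp add: spectral_integral_iff)

lemma spectral_integral_diff:
  assumes \<phi>: "\<phi> \<in> borel_measurable borel"
    and "(x, y) \<in> spectral_integral E \<phi>" "(x', y') \<in> spectral_integral E \<phi>"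
  shows "(x - x', y - y') \<in> spectral_integral E \<phi>"
  using assms
  by (simp add: spectral_integral_iff bounded_linear_bcalc[THEN linear_simps(2)] bounded_borel_trunc
      bounded_linear_proj[THEN linear_simps(2)])

lemma spectral_integral_proj:
  assumes \<phi>[measurable]: "\<phi> \<in> borel_measurable borel" and B[measurable]: "B \<in> sets borel"
    and "(x, y) \<in> spectral_integral E \<phi>"
  shows "(E B x, E B y) \<in> spectral_integral E \<phi>"
  unfolding spectral_integral_iff[OF \<phi>]
proof
  fix n
  have "E {t. \<bar>\<phi> t\<bar> \<le> real n} (E B y) = E B (bcalc E (trunc \<phi> n) x)"
    using assms(3) by (simp add: spectral_integral_iff proj_Int Int_commute flip: proj_Int[of B])
  also have "\<dots> = bcalc E (trunc \<phi> n) (bcalc E (indicator B) x)"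
    by (simp add: proj_bcalc bcalc_mult bounded_borel_trunc bounded_borel_indicator mult.commute)
  finally show "E {t. \<bar>\<phi> t\<bar> \<le> real n} (E B y) = bcalc E (trunc \<phi> n) (E B x)"
    by (simp add: bcalc_indicator)
qed

text \<open>Truncated images have orthogonal increments: the square of
  \<open>norm (Y m - Y n)\<close> is \<open>J m - J n\<close> for \<open>n \<le> m\<close>. As
  \<open>J\<close> converges, \<open>Y\<close> is Cauchy, and its limit satisfies
  \<open>spectral_integral_iff\<close>.\<close>

lemma spectral_integral_exists:
  assumes \<phi>[measurable]: "\<phi> \<in> borel_measurable borel" and x: "x \<in> spectral_dom E \<phi>"
  shows "\<exists>y. (x, y) \<in> spectral_integral E \<phi>"
proof -
  define Y where "Y n = bcalc E (trunc \<phi> n) x" for n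
  define J where "J n = (norm (Y n))\<^sup>2" for n
  have "J \<longlonglongrightarrow> (\<integral>t. (\<phi> t)\<^sup>2 \<partial>scalar_measure E x)"
    using integral_trunc_square_limit[OF \<phi>, of x] x
    by (simp add: J_def[abs_def] Y_def norm_bcalc bounded_borel_trunc spectral_dom_def)
  then have cauchyJ: "Cauchy J" by (rule LIMSEQ_imp_Cauchy)
  have orth: "(norm (Y m - Y n))\<^sup>2 = J m - J n" if "n \<le> m" for m n
  proof -
    let ?C = "{t. \<bar>\<phi> t\<bar> \<le> real n}"
    have "Y m \<bullet> Y n = E ?C (Y m) \<bullet> Y n"
      using proj_bcalc_trunc[OF \<phi>, of n n x] by (simp add: proj_sym Y_def)
    also have "\<dots> = Y n \<bullet> Y n" using that by (simp add: Y_def proj_bcalc_trunc)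
    finally show ?thesis by (simp add: J_def power2_norm_eq_inner algebra_simps inner_commute)
  qed
  have "Cauchy Y"
  proof (rule metric_CauchyI)
    fix e :: real assume e: "e > 0"
    then obtain N where N: "\<And>m n. m \<ge> N \<Longrightarrow> n \<ge> N \<Longrightarrow> \<bar>J m - J n\<bar> < e\<^sup>2"
      using metric_CauchyD[OF cauchyJ, of "e\<^sup>2"] by (auto simp: dist_real_def)
    have "dist (Y m) (Y n) < e" if "m \<ge> N" "n \<ge> N" for m n
    proof (rule power_less_imp_less_base[where n = 2])
      have "(dist (Y m) (Y n))\<^sup>2 = \<bar>J m - J n\<bar>"
        using orth[of m n] orth[of n m] zero_le_power2[of "norm (Y m - Y n)"]
          by (cases "n \<le> m") (auto simp: dist_norm norm_minus_commute[of "Y n"] simp del: zero_le_power2)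
      then show "(dist (Y m) (Y n))\<^sup>2 < e\<^sup>2" using N[OF that] by simp
    qed (use e in simp)
    then show "\<exists>M. \<forall>m\<ge>M. \<forall>n\<ge>M. dist (Y m) (Y n) < e" by blast
  qed
  then obtain y where y: "Y \<longlonglongrightarrow> y" using Cauchy_convergent convergent_def by blast
  have "E {t. \<bar>\<phi> t\<bar> \<le> real n} y = bcalc E (trunc \<phi> n) x" for n
  proof (rule LIMSEQ_unique)
    show "(\<lambda>m. E {t. \<bar>\<phi> t\<bar> \<le> real n} (Y m)) \<longlonglongrightarrow> E {t. \<bar>\<phi> t\<bar> \<le> real n} y"
      by (intro bounded_linear.tendsto[OF bounded_linear_proj] y) simp
    show "(\<lambda>m. E {t. \<bar>\<phi> t\<bar> \<le> real n} (Y m)) \<longlonglongrightarrow> bcalc E (trunc \<phi> n) x"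
      by (rule tendsto_eventually)
        (auto simp: eventually_sequentially Y_def proj_bcalc_trunc intro!: exI[of _ n])
  qed
  then show ?thesis using spectral_integral_iff[OF \<phi>] by blast
qed

lemma spectral_integral_norm:
  assumes \<phi>: "\<phi> \<in> borel_measurable borel" and xy: "(x, y) \<in> spectral_integral E \<phi>"
  shows "(norm y)\<^sup>2 = (\<integral>t. (\<phi> t)\<^sup>2 \<partial>scalar_measure E x)"
proof (rule LIMSEQ_unique)
  show "(\<lambda>n. (norm (E {t. \<bar>\<phi> t\<bar> \<le> real n} y))\<^sup>2) \<longlonglongrightarrow> (norm y)\<^sup>2"
    by (intro tendsto_intros proj_trunc_limit \<phi>)
  show "(\<lambda>n. (norm (E {t. \<bar>\<phi> t\<bar> \<le> real n} y))\<^sup>2) \<longlonglongrightarrow> (\<integral>t. (\<phi> t)\<^sup>2 \<partial>scalar_measure E x)"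
    using integral_trunc_square_limit[OF \<phi>, of x] spectral_integral_dom[OF xy] xy \<phi>
    by (simp add: spectral_dom_def spectral_integral_iff norm_bcalc bounded_borel_trunc)
qed

lemma spectral_integral_inner:
  assumes \<phi>: "\<phi> \<in> borel_measurable borel" and xy: "(x, y) \<in> spectral_integral E \<phi>"
  shows "y \<bullet> x = (\<integral>t. \<phi> t \<partial>scalar_measure E x)"
proof (rule LIMSEQ_unique)
  show "(\<lambda>n. E {t. \<bar>\<phi> t\<bar> \<le> real n} y \<bullet> x) \<longlonglongrightarrow> y \<bullet> x"
    by (intro tendsto_intros proj_trunc_limit \<phi>)
  show "(\<lambda>n. E {t. \<bar>\<phi> t\<bar> \<le> real n} y \<bullet> x) \<longlonglongrightarrow> (\<integral>t. \<phi> t \<partial>scalar_measure E x)"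
    using integral_trunc_limit[OF \<phi> integrable_of_spectral_dom[OF \<phi> spectral_integral_dom[OF xy]]] xy \<phi>
    by (simp add: spectral_integral_iff bcalc_inner sform_self bounded_borel_trunc)
qed

text \<open>For fixed \<open>m\<close> the truncated inverse times the truncations of
  \<open>\<phi>\<close> tends to an indicator. The zero set of \<open>\<phi>\<close>, where
  \<open>inverse 0 = 0\<close> spoils the cancellation, carries no projection by
  \<open>nz\<close>.\<close>

lemma spectral_integral_inverse_subset:
  assumes \<phi>[measurable]: "\<phi> \<in> borel_measurable borel" and nz: "\<And>x. E {t. \<phi> t = 0} x = 0"
    and xy: "(x, y) \<in> spectral_integral E \<phi>"
  shows "(y, x) \<in> spectral_integral E (\<lambda>t. inverse (\<phi> t))"
proof -
  let ?\<psi> = "\<lambda>t. inverse (\<phi> t)"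
  have \<psi>[measurable]: "?\<psi> \<in> borel_measurable borel" by measurable
  have nonzero: "E (- {t. \<phi> t = 0}) x = x" for x
    by (simp add: proj_Compl nz)
  show ?thesis
    unfolding spectral_integral_iff[OF \<psi>]
  proof
    fix m
    let ?D = "{t. \<bar>?\<psi> t\<bar> \<le> real m}"
    interpret L: bounded_linear "bcalc E (trunc ?\<psi> m)"
      by (intro bounded_linear_bcalc bounded_borel_trunc \<psi>)
    have eq: "bcalc E (trunc ?\<psi> m) (E {t. \<bar>\<phi> t\<bar> \<le> real n} y) =
        bcalc E (\<lambda>t. trunc ?\<psi> m t * trunc \<phi> n t) x" for n
      using xy by (simp add: spectral_integral_iff bcalc_mult bounded_borel_trunc)
    have "(\<lambda>n. bcalc E (trunc ?\<psi> m) (E {t. \<bar>\<phi> t\<bar> \<le> real n} y)) \<longlonglongrightarrow> bcalc E (trunc ?\<psi> m) y"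
      by (intro L.tendsto proj_trunc_limit \<phi>)
    moreover have "(\<lambda>n. bcalc E (\<lambda>t. trunc ?\<psi> m t * trunc \<phi> n t) x) \<longlonglongrightarrow>
        bcalc E (indicator (?D \<inter> - {t. \<phi> t = 0})) x"
    proof (rule bcalc_limit[where M = 1])
      show "\<bar>trunc ?\<psi> m t * trunc \<phi> i t\<bar> \<le> 1" for i t
        by (cases "\<phi> t = 0") (auto simp: trunc_def split: split_indicator)
      show "(\<lambda>i. trunc ?\<psi> m t * trunc \<phi> i t) \<longlonglongrightarrow> indicator (?D \<inter> - {t. \<phi> t = 0}) t" for t
      proof -
        have "trunc ?\<psi> m t * \<phi> t = indicator (?D \<inter> - {t. \<phi> t = 0}) t"
          by (cases "\<phi> t = 0") (auto simp: trunc_def split: split_indicator)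
        then show ?thesis
          using tendsto_mult[OF tendsto_const[of "trunc ?\<psi> m t"] trunc_tendsto[of \<phi> t]] by simp
      qed
    qed (auto intro!: bounded_borel_mult bounded_borel_trunc bounded_borel_indicator borel_comp)
    ultimately have "bcalc E (trunc ?\<psi> m) y = bcalc E (indicator (?D \<inter> - {t. \<phi> t = 0})) x"
      using LIMSEQ_unique eq by simp
    also have "\<dots> = E ?D (E (- {t. \<phi> t = 0}) x)"
      by (subst bcalc_indicator) (auto intro!: borel_comp simp: proj_Int)
    finally show "E ?D x = bcalc E (trunc ?\<psi> m) y" by (simp add: nonzero)
  qed
qed

lemma spectral_integral_inverse:
  assumes \<phi>[measurable]: "\<phi> \<in> borel_measurable borel" and nz: "\<And>x. E {t. \<phi> t = 0} x = 0"
  shows "spectral_integral E (\<lambda>t. inverse (\<phi> t)) = (spectral_integral E \<phi>)\<inverse>"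
proof -
  \<comment> \<open>The other inclusion is the same lemma for \<open>inverse (\<phi> t)\<close>,
    because inversion is an involution and preserves the zero set.\<close>
  have "(x, y) \<in> spectral_integral E \<phi>" if "(y, x) \<in> spectral_integral E (\<lambda>t. inverse (\<phi> t))" for x y
    using spectral_integral_inverse_subset[OF _ _ that] nz by simp
  then show ?thesis
    using spectral_integral_inverse_subset[OF assms] by auto
qed

end

section \<open>Spectral subspaces recovered from the operator, and inversion of the spectral
  variable\<close>

section \<open>Uniqueness of the spectral resolution\<close>

text \<open>\<open>proj_measure\<close> says nothing about \<open>E\<close> on non-Borel sets, so
  resolutions can be compared on Borel sets only; the integrals see no more than that.\<close>

lemma spectral_integral_cong_borel:
  assumes "\<And>B. B \<in> sets borel \<Longrightarrow> E B = F B"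
  shows "spectral_integral E \<phi> = spectral_integral F \<phi>"
proof -
  have "scalar_measure E = scalar_measure F"
    unfolding scalar_measure_def using assms sets.sigma_sets_eq[of "borel :: real measure"]
    by (intro ext measure_of_eq) auto
  then show ?thesis by (simp add: spectral_integral_def spectral_dom_def)
qed

context projection_valued
begin

text \<open>On \<open>z = E {- real n..0} x\<close> the first moment is nonnegative by positivity
  and nonpositive by the support, so the measure of \<open>z\<close> sits at 0. Its image is then 0,
  and \<open>inj\<close> gives \<open>z = 0\<close>. Cutting at \<open>- real n\<close> keeps
  \<open>z\<close> in the domain.\<close>

lemma proj_nonpos_eq_0:
  assumes pos: "\<And>x y. (x, y) \<in> spectral_integral E (\<lambda>t. t) \<Longrightarrow> y \<bullet> x \<ge> 0"
    and inj: "\<And>x. (x, 0) \<in> spectral_integral E (\<lambda>t. t) \<Longrightarrow> x = 0"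
  shows "E {..0} x = 0"
proof -
  have zero: "E {- real n..0} x = 0" for n
  proof -
    define z where "z = E {- real n..0} x"
    have "z \<in> spectral_dom E (\<lambda>t. t)"
      unfolding z_def by (rule proj_in_spectral_dom[where K = "real n"]) auto
    then obtain y where y: "(z, y) \<in> spectral_integral E (\<lambda>t. t)"
      using spectral_integral_exists[of "\<lambda>t. t" z] by auto
    have int: "integrable (scalar_measure E z) (\<lambda>t. t)"
      using integrable_of_spectral_dom[of "\<lambda>t. t" z] spectral_integral_dom[OF y] by simp
    have AE: "AE t in scalar_measure E z. t \<in> {- real n..0}"
      by (rule AE_scalar_measure) (simp_all add: z_def proj_Int)
    then have nonpos: "AE t in scalar_measure E z. 0 \<le> - t"
      by eventually_elim simp
    have "0 \<le> (\<integral>t. t \<partial>scalar_measure E z)"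
      using pos[OF y] spectral_integral_inner[OF _ y] by simp
    moreover have "0 \<le> (\<integral>t. - t \<partial>scalar_measure E z)"
      by (rule integral_nonneg_AE[OF nonpos])
    ultimately have "(\<integral>t. - t \<partial>scalar_measure E z) = 0" by simp
    then have "AE t in scalar_measure E z. - t = 0"
      using integral_nonneg_eq_0_iff_AE[OF _ nonpos] int by simp
    then have "AE t in scalar_measure E z. t\<^sup>2 = 0" by eventually_elim simp
    then have "(\<integral>t. t\<^sup>2 \<partial>scalar_measure E z) = (\<integral>t. 0 \<partial>scalar_measure E z)"
      by (intro integral_cong_AE) auto
    then have "y = 0" using spectral_integral_norm[OF _ y] by simp
    then show ?thesis using inj y by (simp add: z_def)
  qed
  have "(\<lambda>n. E {- real n..0} x) \<longlonglongrightarrow> E {..0} x"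
  proof (rule proj_limit)
    fix t :: real
    have "\<forall>\<^sub>F n in sequentially. - t \<le> real n"
      using filterlim_real_sequentially by (simp add: filterlim_at_top)
    then show "\<forall>\<^sub>F n in sequentially. t \<in> {- real n..0} \<longleftrightarrow> t \<in> {..0}"
      by eventually_elim auto
  qed auto
  then show ?thesis by (simp add: zero LIMSEQ_const_iff)
qed

lemma proj_funpow:
  assumes S: "\<And>x. (x, S x) \<in> spectral_integral E (\<lambda>t. t)" and B: "B \<in> sets borel"
  shows "E B ((S ^^ n) x) = (S ^^ n) (E B x)"
proof (induction n)
  case (Suc n)
  have "E B (S v) = S (E B v)" for v
    using spectral_integral_unique[OF _ spectral_integral_proj[OF _ B S] S] by simp
  then show ?case by (simp add: Suc)
qed simp

text \<open>The growth condition mentions \<open>S\<close> alone, so every resolution has the same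
  subspace. There \<open>S\<close> has norm at most \<open>a\<close>; conversely, a component on
  \<open>b \<le> \<bar>t\<bar>\<close> with \<open>b > a\<close> would grow at least like
  \<open>b ^ n\<close>.\<close>

lemma proj_interval_fixes_iff:
  assumes S: "\<And>x. (x, S x) \<in> spectral_integral E (\<lambda>t. t)" and a: "a > 0"
  shows "E {- a..a} x = x \<longleftrightarrow> (\<forall>n. norm ((S ^^ n) x) \<le> a ^ n * norm x)"
proof
  assume x: "E {- a..a} x = x"
  have step: "norm (S v) \<le> a * norm v" if v: "E {- a..a} v = v" for v
  proof (rule power2_le_imp_le)
    have AE: "AE t in scalar_measure E v. t \<in> {- a..a}"
      using v by (intro AE_scalar_measure) auto
    interpret finite_measure "scalar_measure E v" by (rule finite_measure_scalar_measure)
    have sq: "AE t in scalar_measure E v. t\<^sup>2 \<le> a\<^sup>2"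
      using AE by eventually_elim (use a in \<open>auto simp: abs_le_square_iff[symmetric]\<close>)
    have "(norm (S v))\<^sup>2 = (\<integral>t. t\<^sup>2 \<partial>scalar_measure E v)"
      using spectral_integral_norm[OF _ S[of v]] by simp
    also have "\<dots> \<le> (\<integral>t. a\<^sup>2 \<partial>scalar_measure E v)"
      using spectral_integral_dom[OF S[of v]] sq
      by (intro integral_mono_AE) (auto simp: spectral_dom_def)
    also have "\<dots> = (a * norm v)\<^sup>2"
      using measure_scalar_measure[of UNIV v] by (simp add: power_mult_distrib power2_norm_eq_inner)
    finally show "(norm (S v))\<^sup>2 \<le> (a * norm v)\<^sup>2" .
  qed (use a in simp)
  show "\<forall>n. norm ((S ^^ n) x) \<le> a ^ n * norm x"
  proof
    fix n
    show "norm ((S ^^ n) x) \<le> a ^ n * norm x"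
    proof (induction n)
      case (Suc n)
      have "norm (S ((S ^^ n) x)) \<le> a * norm ((S ^^ n) x)"
        using x proj_funpow[OF S, of "{-a..a}" n x] by (intro step) simp
      also have "\<dots> \<le> a * (a ^ n * norm x)" using Suc a by (intro mult_left_mono) auto
      finally show ?case by (simp add: mult.assoc)
    qed simp
  qed
next
  assume growth: "\<forall>n. norm ((S ^^ n) x) \<le> a ^ n * norm x"
  have zero: "E {t. b \<le> \<bar>t\<bar>} x = 0" if b: "b > a" for b
  proof (rule ccontr)
    let ?B = "{t::real. b \<le> \<bar>t\<bar>}"
    define z where "z = E ?B x"
    assume "E ?B x \<noteq> 0"
    then have z: "norm z > 0" by (simp add: z_def)
    have B: "?B \<in> sets borel" by measurable
    have step: "b * norm v \<le> norm (S v)" if v: "E ?B v = v" for v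
    proof (rule power2_le_imp_le)
      have AE: "AE t in scalar_measure E v. t \<in> ?B"
        using v B by (intro AE_scalar_measure) auto
      interpret finite_measure "scalar_measure E v" by (rule finite_measure_scalar_measure)
      have sq: "AE t in scalar_measure E v. b\<^sup>2 \<le> t\<^sup>2"
        using AE by eventually_elim (use a b in \<open>auto simp: abs_le_square_iff[symmetric]\<close>)
      have "(b * norm v)\<^sup>2 = (\<integral>t. b\<^sup>2 \<partial>scalar_measure E v)"
        using measure_scalar_measure[of UNIV v] by (simp add: power_mult_distrib power2_norm_eq_inner)
      also have "\<dots> \<le> (\<integral>t. t\<^sup>2 \<partial>scalar_measure E v)"
        using spectral_integral_dom[OF S[of v]] sq
        by (intro integral_mono_AE) (auto simp: spectral_dom_def)
      also have "\<dots> = (norm (S v))\<^sup>2"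
        using spectral_integral_norm[OF _ S[of v]] by simp
      finally show "(b * norm v)\<^sup>2 \<le> (norm (S v))\<^sup>2" .
    qed simp
    have lower: "b ^ n * norm z \<le> norm ((S ^^ n) z)" for n
    proof (induction n)
      case (Suc n)
      have "E ?B ((S ^^ n) z) = (S ^^ n) z"
        using B proj_funpow[OF S, of ?B n z] by (simp add: z_def proj_Int)
      from step[OF this] have "b * norm ((S ^^ n) z) \<le> norm ((S ^^ Suc n) z)" by simp
      moreover have "b * (b ^ n * norm z) \<le> b * norm ((S ^^ n) z)" using Suc a b by (intro mult_left_mono) auto
      ultimately show ?case by (simp add: mult.assoc)
    qed simp
    have "(b / a) ^ n \<le> norm x / norm z" for n
    proof -
      have "b ^ n * norm z \<le> norm (E ?B ((S ^^ n) x))"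
        using lower[of n] B by (simp add: z_def proj_funpow[OF S])
      also have "\<dots> \<le> a ^ n * norm x"
        using norm_proj_le[OF B, of "(S ^^ n) x"] growth by (meson order_trans)
      finally show ?thesis using a z by (simp add: power_divide field_simps)
    qed
    moreover obtain n where "norm x / norm z < (b / a) ^ n"
      using real_arch_pow[of "b / a" "norm x / norm z"] a b by auto
    ultimately show False by (meson not_le)
  qed
  have "(\<lambda>k. E {t. a + 1 / real (Suc k) \<le> \<bar>t\<bar>} x) \<longlonglongrightarrow> E (- {- a..a}) x"
  proof (rule proj_limit)
    fix t :: real
    show "\<forall>\<^sub>F k in sequentially. t \<in> {t. a + 1 / real (Suc k) \<le> \<bar>t\<bar>} \<longleftrightarrow> t \<in> - {- a..a}"
    proof (cases "t \<in> {- a..a}")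
      case True
      have "\<not> a + 1 / real (Suc k) \<le> \<bar>t\<bar>" for k
      proof -
        have "1 / real (Suc k) > 0" by simp
        moreover have "\<bar>t\<bar> \<le> a" using True by auto
        ultimately show ?thesis by linarith
      qed
      then show ?thesis using True by simp
    next
      case False
      then have "\<bar>t\<bar> - a > 0" by auto
      then have "\<forall>\<^sub>F k in sequentially. 1 / real (Suc k) < \<bar>t\<bar> - a"
        using order_tendstoD(2)[OF LIMSEQ_inverse_real_of_nat] by (simp add: inverse_eq_divide)
      then show ?thesis
        by eventually_elim (use False in auto)
    qed
  next
    show "{t. a + 1 / real (Suc k) \<le> \<bar>t\<bar>} \<in> sets borel" for k by measurable
  qed auto
  moreover have "E {t. a + 1 / real (Suc k) \<le> \<bar>t\<bar>} x = 0" for k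
    by (rule zero) simp
  ultimately have "E (- {- a..a}) x = 0" by (simp add: LIMSEQ_const_iff)
  then show "E {- a..a} x = x" by (simp add: proj_Compl)
qed

text \<open>The growth criterion treats symmetric intervals, the Dynkin argument below half-lines; a
  vanishing nonpositive part reconciles the two.\<close>

lemma proj_atMost_eq_interval:
  assumes "E {..0} x = 0" "a > 0"
  shows "E {..a} x = E {- a..a} x"
proof -
  have "{..< - a} \<inter> {..0} = {..< - a}" using assms(2) by auto
  then have "E {..< - a} x = 0"
    using proj_Int[of "{..< - a}" "{..0}" x] assms(1) by (simp add: bounded_linear_proj[THEN linear_simps(3)])
  then have "E (- {..< - a}) x = x"
    using proj_Compl[of "{..< - a}" x] by simp
  moreover have "{..a} \<inter> {- a..} = {- a..a}" by auto
  ultimately show ?thesis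
    using proj_Int[of "{..a}" "{- a..}" x] by simp
qed

end

text \<open>On symmetric intervals both projections have the same range and are symmetric, hence
  equal; half-lines follow, then all Borel sets by Dynkin's argument.\<close>

theorem spectral_resolution_unique:
  fixes E F :: "real set \<Rightarrow> 'a::{real_inner, complete_space} \<Rightarrow> 'a"
  assumes E: "spectral_resolution {(x, y). y = S x} E" and F: "spectral_resolution {(x, y). y = S x} F"
    and pos: "\<And>x. S x \<bullet> x \<ge> 0" and inj: "\<And>x. S x = 0 \<Longrightarrow> x = 0"
    and B: "B \<in> sets borel"
  shows "E B = F B"
proof -
  interpret E: projection_valued E using E by unfold_locales (simp add: spectral_resolution_def)
  interpret F: projection_valued F using F by unfold_locales (simp add: spectral_resolution_def)
  have grE: "spectral_integral E (\<lambda>t. t) = {(x, y). y = S x}"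
    and grF: "spectral_integral F (\<lambda>t. t) = {(x, y). y = S x}"
    using E F by (simp_all add: spectral_resolution_def)
  have nonposE: "E {..0} x = 0" for x
    by (rule E.proj_nonpos_eq_0) (use pos inj in \<open>auto simp: grE\<close>)
  have nonposF: "F {..0} x = 0" for x
    by (rule F.proj_nonpos_eq_0) (use pos inj in \<open>auto simp: grF\<close>)
  have interval: "E {- a..a} x = F {- a..a} x" if a: "a > 0" for a x
  proof -
    have fix_iff: "E {- a..a} v = v \<longleftrightarrow> F {- a..a} v = v" for v
      using E.proj_interval_fixes_iff[of S a v] F.proj_interval_fixes_iff[of S a v] a
      by (simp add: grE grF)
    have EF: "E {- a..a} (F {- a..a} v) = F {- a..a} v" and FE: "F {- a..a} (E {- a..a} v) = E {- a..a} v" for v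
      using fix_iff[of "E {- a..a} v"] fix_iff[of "F {- a..a} v"] by (simp_all add: E.proj_Int F.proj_Int)
    show ?thesis
      by (rule vector_eq_rdot[THEN iffD1], rule allI)
        (metis E.proj_sym EF F.proj_sym FE borel_closed closed_atLeastAtMost)
  qed
  have atMost: "E {..a} x = F {..a} x" for a x
  proof (cases "a > 0")
    case True
    then show ?thesis
      by (simp add: E.proj_atMost_eq_interval F.proj_atMost_eq_interval nonposE nonposF interval)
  next
    case False
    then have "{..a} \<inter> {..0} = {..a}" by auto
    then show ?thesis
      using E.proj_Int[of "{..a}" "{..0}" x] F.proj_Int[of "{..a}" "{..0}" x]
      by (simp add: nonposE nonposF E.bounded_linear_proj[THEN linear_simps(3)]
          F.bounded_linear_proj[THEN linear_simps(3)])
  qed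
  have sets: "sets borel = sigma_sets UNIV (range (\<lambda>a::real. {..a}))"
    by (subst borel_eq_atMost) (simp add: sets_measure_of)
  have Int_stable: "Int_stable (range (\<lambda>a::real. {..a}))"
    by (auto simp: Int_stable_def)
  have subset_Pow: "range (\<lambda>a::real. {..a}) \<subseteq> Pow UNIV" by simp
  have "E B x = F B x" for x
    using Int_stable subset_Pow B[unfolded sets]
  proof (induction rule: sigma_sets_induct_disjoint)
    case (compl C)
    then show ?case
      by (simp add: E.proj_Compl F.proj_Compl Compl_eq_Diff_UNIV[symmetric] flip: sets)
  next
    case (union C)
    then have "range C \<subseteq> sets borel" by (simp add: sets)
    with union show ?case
      using sums_unique2[OF E.proj_sums[of C x]] F.proj_sums[of C x] by simp
  qed (auto simp: atMost)
  then show ?thesis by blast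
qed

text \<open>Since \<open>inverse 0 = 0\<close>, inversion is an involution of the whole real line, so that
  pushing forward along it is an involution too.\<close>

definition proj_inverse :: "(real set \<Rightarrow> 'a \<Rightarrow> 'a) \<Rightarrow> real set \<Rightarrow> 'a \<Rightarrow> 'a" where
  "proj_inverse E B = E (inverse -` B)"

lemma vimage_inverse_borel [simp]: "B \<in> sets borel \<Longrightarrow> inverse -` B \<in> sets (borel :: real measure)"
  using measurable_sets_borel[of inverse borel B] by simp

lemma proj_measure_proj_inverse:
  assumes "proj_measure E"
  shows "proj_measure (proj_inverse E)"
proof -
  have "disjoint_family (\<lambda>n. inverse -` F n)" if "disjoint_family F" for F :: "nat \<Rightarrow> real set"
    using that by (auto simp: disjoint_family_on_def)
  moreover have "range (\<lambda>n. inverse -` F n) \<subseteq> sets borel" if "range F \<subseteq> sets borel" for F :: "nat \<Rightarrow> real set"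
    using that by (auto simp: image_subset_iff)
  ultimately show ?thesis
    using assms unfolding proj_measure_def proj_inverse_def
    by (simp add: vimage_Int vimage_Union vimage_UN)
qed

lemma spectral_integral_proj_inverse:
  fixes E :: "real set \<Rightarrow> 'a::{real_inner, complete_space} \<Rightarrow> 'a"
  assumes E: "proj_measure E" and \<phi>[measurable]: "\<phi> \<in> borel_measurable borel"
  shows "spectral_integral (proj_inverse E) \<phi> = spectral_integral E (\<lambda>t. \<phi> (inverse t))"
proof -
  interpret E: projection_valued E using E by unfold_locales
  interpret F: projection_valued "proj_inverse E" using proj_measure_proj_inverse[OF E] by unfold_locales
  have "scalar_measure (proj_inverse E) x = distr (scalar_measure E x) borel inverse" for x
    by (rule measure_eqI)
      (simp_all add: emeasure_distr E.emeasure_scalar_measure F.emeasure_scalar_measure proj_inverse_def)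
  then show ?thesis
    by (simp add: spectral_integral_def spectral_dom_def integral_distr integrable_distr_eq)
qed

section \<open>Index functions and form domains\<close>

locale concave_index =
  fixes \<Psi> :: "real \<Rightarrow> real"
  assumes index: "index_function \<Psi>" and concave: "concave_on {0<..} \<Psi>"
    and strict_mono: "strict_mono_on {0<..} \<Psi>"
    and lim_0: "(\<Psi> \<longlongrightarrow> 0) (at_right 0)" and lim_top: "filterlim \<Psi> at_top at_top"
begin

lemma Psi_pos: "0 < r \<Longrightarrow> 0 < \<Psi> r"
  using index by (simp add: index_function_def)

text \<open>Intermediate value theorem between a point near 0 and one near infinity; it makes
  \<open>the_inv_into\<close> a genuine inverse on all of \<open>{0<..}\<close>.\<close>

lemma Psi_surj:
  assumes "0 < r"
  shows "\<exists>u>0. \<Psi> u = r"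
proof -
  have "\<forall>\<^sub>F u in at_right 0. \<Psi> u < r \<and> 0 < u"
    using order_tendstoD(2)[OF lim_0 assms] eventually_at_right_less by (rule eventually_conj)
  then obtain a where a: "\<Psi> a < r" "0 < a"
    using eventually_happens'[of "at_right (0::real)"] by auto
  have "\<forall>\<^sub>F u in at_top. r \<le> \<Psi> u \<and> a \<le> u"
    using lim_top by (intro eventually_conj eventually_ge_at_top) (simp add: filterlim_at_top)
  then obtain b where b: "r \<le> \<Psi> b" "a \<le> b"
    using eventually_happens'[of "at_top :: real filter"] by auto
  have "continuous_on {a..b} \<Psi>"
    by (rule continuous_on_subset[of "{0<..}"]) (use index a in \<open>auto simp: index_function_def\<close>)
  then obtain u where "a \<le> u" "\<Psi> u = r"
    using IVT'[of \<Psi> a r b] a b by auto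
  then show ?thesis using a by (intro exI[of _ u]) auto
qed

lemma Psi_inv:
  assumes "0 < r"
  shows "0 < the_inv_into {0<..} \<Psi> r" "\<Psi> (the_inv_into {0<..} \<Psi> r) = r"
proof -
  have inj: "inj_on \<Psi> {0<..}" using strict_mono by (rule strict_mono_on_imp_inj_on)
  obtain u where "0 < u" "\<Psi> u = r" using Psi_surj[OF assms] by blast
  then have "the_inv_into {0<..} \<Psi> r = u" using the_inv_into_f_f[OF inj] by auto
  then show "0 < the_inv_into {0<..} \<Psi> r" "\<Psi> (the_inv_into {0<..} \<Psi> r) = r"
    using \<open>0 < u\<close> \<open>\<Psi> u = r\<close> by simp_all
qed

lemma chi_pos: "0 < r \<Longrightarrow> 0 < chi \<Psi> r"
  by (simp add: chi_def Psi_inv)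

lemma chi_nonneg: "0 \<le> chi \<Psi> r"
  using chi_pos[of r] by (cases "0 < r") (auto simp: chi_def)

lemma chi_eq_0_iff: "chi \<Psi> r = 0 \<longleftrightarrow> r \<le> 0"
  using chi_pos[of r] by (cases "0 < r") (auto simp: chi_def)

text \<open>The inverse of \<open>\<Psi>\<close>, extended by 0, is monotone on the whole line and
  therefore Borel.\<close>

lemma borel_measurable_chi [measurable]: "chi \<Psi> \<in> borel_measurable borel"
proof -
  define inv' where "inv' r = (if 0 < r then the_inv_into {0<..} \<Psi> r else 0)" for r
  have "mono inv'"
  proof (rule monoI)
    fix r s :: real assume "r \<le> s"
    show "inv' r \<le> inv' s"
    proof (cases "0 < r")
      case True
      show ?thesis
      proof (rule ccontr)
        assume "\<not> inv' r \<le> inv' s"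
        then have "\<Psi> (inv' s) < \<Psi> (inv' r)"
          using True \<open>r \<le> s\<close> Psi_inv by (intro strict_mono_onD[OF strict_mono]) (auto simp: inv'_def)
        then show False using True \<open>r \<le> s\<close> Psi_inv by (simp add: inv'_def)
      qed
    next
      case False
      then show ?thesis using Psi_inv(1)[of s] by (auto simp: inv'_def)
    qed
  qed
  then have [measurable]: "inv' \<in> borel_measurable borel" by (rule borel_measurable_mono)
  have "chi \<Psi> = (\<lambda>r. inv' r / r)" by (auto simp: chi_def inv'_def)
  then show ?thesis by simp
qed

text \<open>For \<open>t \<le> 0\<close> both sides are 0, as \<open>chi\<close> vanishes at
  nonpositive arguments and \<open>inverse 0 = 0\<close>.\<close>

lemma psibar_eq: "psibar \<Psi> t = inverse (sqrt (chi \<Psi> (inverse t)))"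
  by (simp add: psibar_def inverse_eq_divide chi_def)

text \<open>Monotonicity for \<open>u \<le> s\<close>. For \<open>u > s\<close> concavity puts the
  graph above the chord from the origin, so \<open>\<Psi> u \<le> \<Psi> s * (u / s)\<close>; the
  sum of the two bounds covers both cases.\<close>

lemma Psi_le_linear:
  assumes "0 < s" "0 < u"
  shows "\<Psi> u \<le> \<Psi> s * (1 + u / s)"
proof (cases "u \<le> s")
  case True
  then have "\<Psi> u \<le> \<Psi> s"
    using strict_mono_onD[OF strict_mono, of u s] assms by (cases "u = s") auto
  moreover have "0 \<le> \<Psi> s * (u / s)" using assms Psi_pos[of s] by simp
  ultimately show ?thesis by (simp add: algebra_simps)
next
  case False
  then have "s < u" by simp
  \<comment> \<open>Concavity is given on \<open>{0<..}\<close> only, so the chord starts at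
    \<open>e\<close>, where \<open>\<Psi>\<close> is positive, and \<open>e\<close> tends to 0
    afterwards.\<close>
  have "(s - e) / (u - e) * \<Psi> u \<le> \<Psi> s" if e: "0 < e" "e < s" for e
  proof -
    define p where "p = (s - e) / (u - e)"
    have p: "0 \<le> p" "p \<le> 1" using e \<open>s < u\<close> by (auto simp: p_def)
    have "p * (u - e) = s - e" using e \<open>s < u\<close> by (simp add: p_def)
    then have s: "(1 - p) * e + p * u = s" by (simp add: algebra_simps)
    have "(1 - p) * \<Psi> e + p * \<Psi> u \<le> \<Psi> ((1 - p) *\<^sub>R e + p *\<^sub>R u)"
      by (rule concave_onD[OF concave]) (use p e assms in auto)
    moreover have "0 \<le> (1 - p) * \<Psi> e" using p Psi_pos[of e] e by simp
    ultimately show ?thesis by (simp add: s flip: p_def)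
  qed
  then have "\<forall>\<^sub>F e in at_right 0. (s - e) / (u - e) * \<Psi> u \<le> \<Psi> s"
    unfolding eventually_at_right[OF \<open>0 < s\<close>] using \<open>0 < s\<close> by blast
  moreover have "((\<lambda>e. (s - e) / (u - e) * \<Psi> u) \<longlongrightarrow> (s - 0) / (u - 0) * \<Psi> u) (at_right 0)"
    by (intro tendsto_intros) (use assms in auto)
  ultimately have "s / u * \<Psi> u \<le> \<Psi> s"
    using tendsto_upperbound[of _ _ "at_right (0::real)"] by simp
  then have "\<Psi> u \<le> \<Psi> s * (u / s)" using assms by (simp add: field_simps)
  then show ?thesis using Psi_pos[OF assms(1)] by (simp add: algebra_simps)
qed

text \<open>Replaces the interpolation inequality of the variable Hilbert scale: integrated against a
  spectral measure it splits the norm into the weak and the strong one.\<close>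

lemma one_le_Psi_chi:
  assumes "0 < r" "0 < s"
  shows "1 \<le> \<Psi> s * (inverse r + chi \<Psi> r / s)"
proof -
  define u where "u = the_inv_into {0<..} \<Psi> r"
  have u: "0 < u" "\<Psi> u = r" using Psi_inv[OF assms(1)] by (simp_all add: u_def)
  have "r \<le> \<Psi> s * (1 + u / s)" using Psi_le_linear[OF assms(2) u(1)] u(2) by simp
  then have "1 \<le> \<Psi> s * (1 + u / s) / r" using assms(1) by simp
  also have "\<dots> = \<Psi> s * (inverse r + chi \<Psi> r / s)"
    using assms by (simp add: chi_def u_def field_simps)
  finally show ?thesis .
qed

end

section \<open>Form domains as domains of square roots\<close>

context projection_valued
begin

lemma spectral_dom_sqrt_iff:
  "(\<And>t. 0 \<le> \<phi> t) \<Longrightarrow> x \<in> spectral_dom E (\<lambda>t. sqrt (\<phi> t)) \<longleftrightarrow> integrable (scalar_measure E x) \<phi>"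
  by (simp add: spectral_dom_def)

lemma norm_bcalc_trunc_sqrt_le:
  assumes \<phi>[measurable]: "\<phi> \<in> borel_measurable borel" and nn: "\<And>t. 0 \<le> \<phi> t"
    and int: "integrable (scalar_measure E x) \<phi>"
  shows "norm (bcalc E (trunc (\<lambda>t. sqrt (\<phi> t)) k) x) \<le> sqrt (\<integral>t. \<phi> t \<partial>scalar_measure E x)"
proof (rule real_le_rsqrt)
  let ?r = "\<lambda>t. sqrt (\<phi> t)"
  have b: "bounded_borel (trunc ?r k)" by (rule bounded_borel_trunc) measurable
  show "(norm (bcalc E (trunc ?r k) x))\<^sup>2 \<le> (\<integral>t. \<phi> t \<partial>scalar_measure E x)"
    unfolding norm_bcalc[OF b]
  proof (rule integral_mono[OF _ int])
    show "integrable (scalar_measure E x) (\<lambda>t. (trunc ?r k t)\<^sup>2)"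
      unfolding power2_eq_square by (intro integrable_bounded_borel bounded_borel_mult b)
    show "(trunc ?r k t)\<^sup>2 \<le> \<phi> t" for t
      using power_mono[OF abs_trunc_le(2)[of ?r k t] abs_ge_zero, of 2] nn[of t] by simp
  qed
qed

text \<open>The form norm is the norm of the image under the square root. A Cauchy sequence keeps
  the truncated images bounded, which passes to \<open>h\<close> at each fixed level
  \<open>k\<close>; conversely, spectral cut-offs of \<open>h\<close> are a suitable sequence, as
  those of \<open>u\<close> converge in norm.\<close>

lemma form_closure_eq_spectral_dom:
  assumes \<phi>[measurable]: "\<phi> \<in> borel_measurable borel" and nn: "\<And>t. 0 \<le> \<phi> t"
  shows "{h. \<exists>s y. (\<forall>n. (s n, y n) \<in> spectral_integral E \<phi>) \<and> s \<longlonglongrightarrow> h \<and>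
      (\<forall>e>0. \<exists>N. \<forall>m\<ge>N. \<forall>n\<ge>N. sqrt ((s m - s n) \<bullet> (y m - y n)) < e)} =
    spectral_dom E (\<lambda>t. sqrt (\<phi> t))" (is "?L = ?R")
proof (intro set_eqI iffI)
  let ?r = "\<lambda>t. sqrt (\<phi> t)"
  have r: "?r \<in> borel_measurable borel" by measurable
  fix h
  {
    assume "h \<in> ?L"
    then obtain s y where sy: "\<And>n. (s n, y n) \<in> spectral_integral E \<phi>" and lim: "s \<longlonglongrightarrow> h"
      and cauchy: "\<And>e. e > 0 \<Longrightarrow> \<exists>N. \<forall>m\<ge>N. \<forall>n\<ge>N. sqrt ((s m - s n) \<bullet> (y m - y n)) < e"
      by blast
    \<comment> \<open>The tolerance 1 suffices here, since domain membership is a boundedness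
      condition.\<close>
    obtain N where N: "\<And>m n. m \<ge> N \<Longrightarrow> n \<ge> N \<Longrightarrow> sqrt ((s m - s n) \<bullet> (y m - y n)) < 1"
      using cauchy[of 1] by auto
    have "integrable (scalar_measure E (s N)) \<phi>"
      by (rule integrable_of_spectral_dom[OF \<phi> spectral_integral_dom[OF sy]])
    then obtain K where K: "\<And>k. norm (bcalc E (trunc ?r k) (s N)) \<le> K"
      using norm_bcalc_trunc_sqrt_le[OF \<phi> nn] by blast
    have "norm (bcalc E (trunc ?r k) h) \<le> 1 + K" for k
    proof -
      interpret R: bounded_linear "bcalc E (trunc ?r k)"
        by (intro bounded_linear_bcalc bounded_borel_trunc r)
      have "norm (bcalc E (trunc ?r k) (s m)) \<le> 1 + K" if "m \<ge> N" for m
      proof -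
        have d: "(s m - s N, y m - y N) \<in> spectral_integral E \<phi>"
          by (rule spectral_integral_diff[OF \<phi> sy sy])
        have "norm (bcalc E (trunc ?r k) (s m - s N)) \<le> sqrt ((s m - s N) \<bullet> (y m - y N))"
          using norm_bcalc_trunc_sqrt_le[OF \<phi> nn integrable_of_spectral_dom[OF \<phi> spectral_integral_dom[OF d]], of k]
          by (simp add: spectral_integral_inner[OF \<phi> d, symmetric] inner_commute)
        also have "\<dots> \<le> 1" using N[OF that, of N] by simp
        finally have "norm (bcalc E (trunc ?r k) (s m) - bcalc E (trunc ?r k) (s N)) \<le> 1"
          by (simp add: R.diff)
        then show ?thesis
          using K[of k] norm_triangle_sub[of "bcalc E (trunc ?r k) (s m)" "bcalc E (trunc ?r k) (s N)"]
          by linarith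
      qed
      then show ?thesis
        by (intro LIMSEQ_le_const2[OF tendsto_norm[OF R.tendsto[OF lim]]]) blast
    qed
    then show "h \<in> ?R" unfolding spectral_dom_iff[OF r] by blast
  }
  {
    assume "h \<in> ?R"
    then obtain u where u: "(h, u) \<in> spectral_integral E ?r"
      using spectral_integral_exists[OF r] by blast
    define P where "P n = E {t. \<bar>\<phi> t\<bar> \<le> real n}" for n
    have "\<exists>y. (P n h, y) \<in> spectral_integral E \<phi>" for n
      unfolding P_def by (intro spectral_integral_exists \<phi> proj_in_spectral_dom[where K = "real n"]) auto
    then obtain y where y: "\<And>n. (P n h, y n) \<in> spectral_integral E \<phi>" by metis
    have eq: "sqrt ((P m h - P n h) \<bullet> (y m - y n)) = norm (P m u - P n u)" for m n
    proof -
      have "(P m h - P n h) \<bullet> (y m - y n) = (\<integral>t. \<phi> t \<partial>scalar_measure E (P m h - P n h))"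
        using spectral_integral_inner[OF \<phi> spectral_integral_diff[OF \<phi> y y], of m n]
        by (simp add: inner_commute)
      also have "\<dots> = (norm (P m u - P n u))\<^sup>2"
        using spectral_integral_norm[OF r spectral_integral_diff[OF r spectral_integral_proj[OF r _ u]
              spectral_integral_proj[OF r _ u]], of "{t. \<bar>\<phi> t\<bar> \<le> real m}" "{t. \<bar>\<phi> t\<bar> \<le> real n}"] nn
        by (simp add: P_def)
      finally show ?thesis by simp
    qed
    have "Cauchy (\<lambda>n. P n u)"
      unfolding P_def by (rule LIMSEQ_imp_Cauchy[OF proj_trunc_limit[OF \<phi>]])
    then have "\<forall>e>0. \<exists>N. \<forall>m\<ge>N. \<forall>n\<ge>N. sqrt ((P m h - P n h) \<bullet> (y m - y n)) < e"
      by (simp add: eq Cauchy_def dist_norm)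
    moreover have "(\<lambda>n. P n h) \<longlonglongrightarrow> h" unfolding P_def by (rule proj_trunc_limit[OF \<phi>])
    ultimately show "h \<in> ?L"
      using y by (intro CollectI exI[of _ "\<lambda>n. P n h"] exI[of _ y] conjI) blast+
  }
qed

text \<open>The closed graph theorem for an operator into a form domain, by uniform boundedness of the
  truncated forms.\<close>

lemma form_bounded_of_range_subset:
  fixes G :: "'b::{real_normed_vector, complete_space} \<Rightarrow> 'a"
  assumes \<phi>[measurable]: "\<phi> \<in> borel_measurable borel" and nn: "\<And>t. 0 \<le> \<phi> t"
    and G: "bounded_linear G" and range: "\<And>v. G v \<in> spectral_dom E (\<lambda>t. sqrt (\<phi> t))"
  shows "\<exists>C. \<forall>v. (\<integral>t. \<phi> t \<partial>scalar_measure E (G v)) \<le> C * (norm v)\<^sup>2"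
proof -
  let ?r = "\<lambda>t. sqrt (\<phi> t)"
  have r: "?r \<in> borel_measurable borel" by measurable
  \<comment> \<open>Domain membership of \<open>G v\<close> is pointwise boundedness at
    \<open>v\<close> of the truncated operators composed with \<open>G\<close>.\<close>
  have "\<exists>C. \<forall>k v. norm (bcalc E (trunc ?r k) (G v)) \<le> C * norm v"
    by (rule uniform_boundedness)
      (use range in \<open>auto simp: spectral_dom_iff[OF r] intro!: bounded_linear_compose[OF _ G] bounded_linear_bcalc
        bounded_borel_trunc r\<close>)
  then obtain C where C: "\<And>k v. norm (bcalc E (trunc ?r k) (G v)) \<le> C * norm v" by blast
  have "(\<integral>t. \<phi> t \<partial>scalar_measure E (G v)) \<le> C\<^sup>2 * (norm v)\<^sup>2" for v
  proof (rule LIMSEQ_le_const2)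
    have "integrable (scalar_measure E (G v)) (\<lambda>t. (?r t)\<^sup>2)"
      using range[of v] by (simp add: spectral_dom_def)
    from integral_trunc_square_limit[OF r this]
    show "(\<lambda>k. (norm (bcalc E (trunc ?r k) (G v)))\<^sup>2) \<longlonglongrightarrow> (\<integral>t. \<phi> t \<partial>scalar_measure E (G v))"
      by (simp add: norm_bcalc bounded_borel_trunc nn)
    have "(norm (bcalc E (trunc ?r k) (G v)))\<^sup>2 \<le> (C * norm v)\<^sup>2" for k
      by (intro power_mono C) simp
    then show "\<exists>N. \<forall>k\<ge>N. (norm (bcalc E (trunc ?r k) (G v)))\<^sup>2 \<le> C\<^sup>2 * (norm v)\<^sup>2"
      unfolding power_mult_distrib by blast
  qed
  then show ?thesis by blast
qed

end

section \<open>Both descriptions of the scale space, interpolation and the error estimate\<close>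

section \<open>The scale of the inverse normal operator and the convergence rate\<close>

text \<open>\<open>E\<close> resolves the inverse \<open>T\<close>, whose graph is the converse of
  \<open>normal_op A\<close>, because the scale is defined through \<open>T\<close>. Its existence
  is assumed here and supplied in the theorem by the link condition.\<close>

locale inverse_normal_resolution = concave_index \<Psi> for \<Psi> +
  fixes A :: "'a::{real_inner, complete_space} \<Rightarrow> 'b::real_inner" and E :: "real set \<Rightarrow> 'a \<Rightarrow> 'a"
  assumes A: "bounded_linear A" "inj A"
    and resolution: "spectral_resolution ((normal_op A)\<inverse>) E"
begin

sublocale projection_valued E
  using resolution by unfold_locales (simp add: spectral_resolution_def)

abbreviation S :: "'a \<Rightarrow> 'a" where "S x \<equiv> adjoint A (A x)"

lemma S_inner: "S x \<bullet> x = (norm (A x))\<^sup>2"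
  using adjoint_inner[OF A(1), of x "A x"] by (simp add: power2_norm_eq_inner inner_commute)

lemma S_eq_0: "S x = 0 \<Longrightarrow> x = 0"
  using S_inner[of x] A injD[of A x 0] by (simp add: linear_simps(3))

lemma normal_op_eq: "normal_op A = {(x, y). y = S x}"
  by (simp add: normal_op_def)

lemma spectral_integral_id: "spectral_integral E (\<lambda>t. t) = (normal_op A)\<inverse>"
  using resolution by (simp add: spectral_resolution_def)

text \<open>Pairs in the graph of \<open>T\<close> are of the form \<open>(S y, y)\<close>: its form
  is the square norm of \<open>A y\<close>, and its kernel is trivial because
  \<open>S 0 = 0\<close>.\<close>

lemma proj_nonpos: "E {..0} x = 0"
proof (rule proj_nonpos_eq_0)
  have "S 0 = 0"
    using A(1) bounded_linear_adjoint[OF A(1)] by (simp add: linear_simps(3))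
  then show "x = 0" if "(x, 0) \<in> spectral_integral E (\<lambda>t. t)" for x
    using that by (simp add: spectral_integral_id normal_op_eq)
  show "y \<bullet> x \<ge> 0" if "(x, y) \<in> spectral_integral E (\<lambda>t. t)" for x y
    using that S_inner[of y] by (simp add: spectral_integral_id normal_op_eq inner_commute)
qed

lemma AE_pos: "AE t in scalar_measure E x. 0 < t"
proof -
  have "E (- {..0}) x = x" using proj_Compl[of "{..0}" x] by (simp add: proj_nonpos)
  then have "AE t in scalar_measure E x. t \<in> - {..0}"
    by (intro AE_scalar_measure) auto
  then show ?thesis by eventually_elim auto
qed

lemma spectral_integral_inverse_normal: "spectral_integral E inverse = normal_op A"
proof -
  have "E {0} x = 0" for x
    using proj_Int[of "{0}" "{..0}" x]
    by (simp add: proj_nonpos bounded_linear_proj[THEN linear_simps(3)])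
  then show ?thesis
    using spectral_integral_inverse[of "\<lambda>t. t"] by (simp add: spectral_integral_id)
qed

lemma proj_inverse_resolution: "spectral_resolution (normal_op A) (proj_inverse E)"
  using proj_measure spectral_integral_proj_inverse[OF proj_measure, of "\<lambda>t. t"]
  by (simp add: spectral_resolution_def proj_measure_proj_inverse spectral_integral_inverse_normal)

lemma normal_resolution_unique:
  assumes "spectral_resolution (normal_op A) F" "B \<in> sets borel"
  shows "F B = proj_inverse E B"
  using assms proj_inverse_resolution unfolding normal_op_eq
  by (intro spectral_resolution_unique[where S = S]) (auto simp: S_inner S_eq_0)

text \<open>Uniqueness is known for the everywhere defined operator \<open>S\<close>: the images of
  \<open>F\<close> and \<open>E\<close> under inversion both resolve \<open>normal_op A\<close>, and
  inverting again recovers \<open>F\<close> and \<open>E\<close>.\<close>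

lemma inverse_normal_resolution_unique:
  assumes F: "spectral_resolution ((normal_op A)\<inverse>) F" and B: "B \<in> sets borel"
  shows "F B = E B"
proof -
  interpret F: inverse_normal_resolution \<Psi> A F
    by (intro inverse_normal_resolution.intro concave_index_axioms inverse_normal_resolution_axioms.intro A F)
  have "proj_inverse F (inverse -` B) = proj_inverse E (inverse -` B)"
    by (rule normal_resolution_unique[OF F.proj_inverse_resolution]) (simp add: B)
  then show ?thesis by (simp add: proj_inverse_def vimage_def)
qed

lemma fun_calc_inverse_normal: "fun_calc ((normal_op A)\<inverse>) \<phi> = spectral_integral E \<phi>"
proof -
  have "spectral_integral F \<phi> = spectral_integral E \<phi>" if "spectral_resolution ((normal_op A)\<inverse>) F" for F
    by (rule spectral_integral_cong_borel) (rule inverse_normal_resolution_unique[OF that])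
  with resolution have "(x, y) \<in> fun_calc ((normal_op A)\<inverse>) \<phi> \<longleftrightarrow> (x, y) \<in> spectral_integral E \<phi>" for x y
    unfolding fun_calc_def by blast
  then show ?thesis by auto
qed

lemma fun_calc_normal: "fun_calc (normal_op A) \<phi> = spectral_integral (proj_inverse E) \<phi>"
proof -
  have "spectral_integral F \<phi> = spectral_integral (proj_inverse E) \<phi>" if "spectral_resolution (normal_op A) F" for F
    by (rule spectral_integral_cong_borel) (rule normal_resolution_unique[OF that])
  with proj_inverse_resolution
  have "(x, y) \<in> fun_calc (normal_op A) \<phi> \<longleftrightarrow> (x, y) \<in> spectral_integral (proj_inverse E) \<phi>" for x y
    unfolding fun_calc_def by blast
  then show ?thesis by auto
qed

lemma scale_space_eq: "scale_space ((normal_op A)\<inverse>) (chi \<Psi>) = spectral_dom E (\<lambda>t. sqrt (chi \<Psi> t))"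
  unfolding scale_space_def fun_calc_inverse_normal
  by (rule form_closure_eq_spectral_dom) (simp_all add: chi_nonneg)

text \<open>After the substitution \<open>1 / t\<close>, \<open>psibar \<Psi>\<close> of the normal
  operator is the inverse of the square root of \<open>chi \<Psi>\<close> of \<open>T\<close>, and
  the range of an inverse is the domain of the operator.\<close>

lemma Range_psibar_eq: "Range (fun_calc (normal_op A) (psibar \<Psi>)) = spectral_dom E (\<lambda>t. sqrt (chi \<Psi> t))"
proof -
  let ?r = "\<lambda>t. sqrt (chi \<Psi> t)"
  have r: "?r \<in> borel_measurable borel" by measurable
  have "psibar \<Psi> = (\<lambda>t. inverse (?r (inverse t)))" by (simp add: psibar_eq fun_eq_iff)
  then have "fun_calc (normal_op A) (psibar \<Psi>) = spectral_integral E (\<lambda>t. inverse (?r t))"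
    unfolding fun_calc_normal by (simp add: spectral_integral_proj_inverse[OF proj_measure])
  also have "\<dots> = (spectral_integral E ?r)\<inverse>"
  proof (rule spectral_integral_inverse[OF r])
    have "{t. ?r t = 0} = {..0}" by (auto simp: chi_eq_0_iff)
    then show "E {t. ?r t = 0} x = 0" for x by (simp add: proj_nonpos)
  qed
  finally have "Range (fun_calc (normal_op A) (psibar \<Psi>)) = Domain (spectral_integral E ?r)" by simp
  then show ?thesis
    using spectral_integral_exists[OF r] spectral_integral_dom by blast
qed

text \<open>\<open>one_le_Psi_chi\<close> holds almost everywhere, the measure being carried by
  positive numbers. The integral of \<open>inverse\<close> is \<open>S h \<bullet> h\<close>, which
  is the weak norm squared.\<close>

lemma norm_le_weak_strong:
  assumes h: "h \<in> spectral_dom E (\<lambda>t. sqrt (chi \<Psi> t))" and s: "0 < s"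
  shows "(norm h)\<^sup>2 \<le> \<Psi> s * ((norm (A h))\<^sup>2 + (\<integral>t. chi \<Psi> t \<partial>scalar_measure E h) / s)"
proof -
  interpret finite_measure "scalar_measure E h" by (rule finite_measure_scalar_measure)
  have S: "(h, S h) \<in> spectral_integral E inverse"
    by (simp add: spectral_integral_inverse_normal normal_op_eq)
  have int: "integrable (scalar_measure E h) (chi \<Psi>)" "integrable (scalar_measure E h) inverse"
    using h spectral_dom_sqrt_iff[of "chi \<Psi>"] chi_nonneg
      integrable_of_spectral_dom[OF _ spectral_integral_dom[OF S]] by auto
  have "(norm h)\<^sup>2 = (\<integral>t. 1 \<partial>scalar_measure E h)"
    using measure_scalar_measure[of UNIV h] by (simp add: power2_norm_eq_inner)
  also have "\<dots> \<le> (\<integral>t. \<Psi> s * (inverse t + chi \<Psi> t / s) \<partial>scalar_measure E h)"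
  proof (rule integral_mono_AE)
    show "AE t in scalar_measure E h. 1 \<le> \<Psi> s * (inverse t + chi \<Psi> t / s)"
      using AE_pos[of h] by eventually_elim (rule one_le_Psi_chi[OF _ s])
  qed (use int in auto)
  also have "\<dots> = \<Psi> s * ((\<integral>t. inverse t \<partial>scalar_measure E h) + (\<integral>t. chi \<Psi> t \<partial>scalar_measure E h) / s)"
    using int by simp
  also have "(\<integral>t. inverse t \<partial>scalar_measure E h) = (norm (A h))\<^sup>2"
    using spectral_integral_inner[OF _ S] by (simp add: S_inner)
  finally show ?thesis .
qed

end

text \<open>The witness is \<open>e = w - v\<close>, where \<open>v\<close> solves the regularised
  normal equation; coercivity with constant \<open>a\<close> makes \<open>inv\<close> in
  \<open>regularised\<close> a genuine inverse.\<close>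

lemma regularised_error:
  fixes A :: "'a::{real_inner, complete_space} \<Rightarrow> 'b::real_inner"
  assumes A: "bounded_linear A" and G: "bounded_linear G" and sym: "\<And>x y. G x \<bullet> y = x \<bullet> G y"
    and a: "0 < a" and noise: "norm (A (G w) - d) \<le> \<delta>"
  shows "\<exists>e. G w - regularised A G a d = G e \<and> (norm (A (G e)))\<^sup>2 + a * (norm e)\<^sup>2 \<le> \<delta>\<^sup>2 + a * (norm w)\<^sup>2"
proof -
  interpret A: bounded_linear A by (rule A)
  interpret G: bounded_linear G by (rule G)
  define L where "L x = G (adjoint A (A (G x))) + a *\<^sub>R x" for x
  have adj: "G (adjoint A u) \<bullet> y = u \<bullet> A (G y)" for u y
    using adjoint_inner[OF A, of "G y" u] sym[of "adjoint A u" y] by (simp add: inner_commute)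
  have inner: "L x \<bullet> y = A (G x) \<bullet> A (G y) + a * (x \<bullet> y)" for x y
    by (simp add: L_def inner_add_left adj)
  have L: "bounded_linear L"
    unfolding L_def
    by (intro bounded_linear_add bounded_linear_compose[OF G] bounded_linear_compose[OF bounded_linear_adjoint[OF A]]
        bounded_linear_compose[OF A G] bounded_linear_scaleR_right)
  interpret L: bounded_linear L by (rule L)
  have "bij L"
  proof (rule coercive_imp_bij[OF L a])
    show "L x \<bullet> x \<ge> a * (norm x)\<^sup>2" for x by (simp add: inner power2_norm_eq_inner)
  qed
  define v where "v = inv L (G (adjoint A d))"
  have Lv: "L v = G (adjoint A d)" using \<open>bij L\<close> by (simp add: v_def surj_f_inv_f bij_is_surj)
  define e where "e = w - v"
  have "regularised A G a d = G v" by (simp add: regularised_def v_def L_def[abs_def])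
  then have "G w - regularised A G a d = G e" by (simp add: e_def G.diff)
  moreover have "(norm (A (G e)))\<^sup>2 + a * (norm e)\<^sup>2 \<le> \<delta>\<^sup>2 + a * (norm w)\<^sup>2"
  proof -
    have "(norm (A (G e)))\<^sup>2 + a * (norm e)\<^sup>2 = (L w - L v) \<bullet> e"
      by (simp add: inner power2_norm_eq_inner e_def flip: L.diff)
    also have "\<dots> = (A (G w) - d) \<bullet> A (G e) + a * (w \<bullet> e)"
      by (simp add: Lv inner inner_diff_left adj)
    also have "\<dots> \<le> \<delta> * norm (A (G e)) + a * (norm w * norm e)"
      using a by (intro add_mono mult_left_mono norm_cauchy_schwarz
        order_trans[OF norm_cauchy_schwarz mult_right_mono[OF noise]]) auto
    \<comment> \<open>Young's inequality for both products; the halves containing \<open>e\<close>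
      are absorbed on the left, which removes the factor 1/2.\<close>
    also have "\<dots> \<le> (\<delta>\<^sup>2 + (norm (A (G e)))\<^sup>2) / 2 + a * (((norm w)\<^sup>2 + (norm e)\<^sup>2) / 2)"
      using a zero_le_power2[of "\<delta> - norm (A (G e))"] zero_le_power2[of "norm w - norm e"]
      by (intro add_mono mult_left_mono) (auto simp: power2_diff)
    finally show ?thesis by (simp add: field_simps)
  qed
  ultimately show ?thesis by blast
qed

text \<open>The first conjunct records that both descriptions of the space in the link condition
  agree. \<open>K\<close> is fixed before the data family, so one value serves all admissible
  data.\<close>

theorem proposition4p2:
  fixes A :: "'x::{real_inner, polish_space} \<Rightarrow> 'y::{real_inner, polish_space}"
    and G :: "'x \<Rightarrow> 'x"
    and \<Psi> :: "real \<Rightarrow> real"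
    and f w :: 'x and g :: 'y
    and \<alpha> :: "real \<Rightarrow> real"
    and c\<^sub>1 c\<^sub>2 \<delta>max :: real
  assumes X_infinite_dim: "\<nexists>B::'x set. finite B \<and> span B = UNIV"
    and Y_infinite_dim: "\<nexists>B::'y set. finite B \<and> span B = UNIV"
    and A: "bounded_linear A" "inj A" "\<not> closed (range A)"
    and Psi: "index_function \<Psi>" "concave_on {0<..} \<Psi>" "strict_mono_on {0<..} \<Psi>"
      "(\<Psi> \<longlongrightarrow> 0) (at_right 0)" "filterlim \<Psi> at_top at_top"
      "((\<lambda>r. \<Psi> r / r) \<longlongrightarrow> 0) at_top"
    and G: "bounded_linear G" "inj G" "\<not> closed (range G)"
      "\<And>x y. G x \<bullet> y = x \<bullet> G y" "\<And>x. x \<noteq> 0 \<Longrightarrow> G x \<bullet> x > 0"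
    and source: "A f = g" "f = G w"
    and link: "range G \<subseteq> scale_space ((normal_op A)\<inverse>) (chi \<Psi>)"
    and delta_max: "\<delta>max > 0"
    and constants: "0 < c\<^sub>1" "c\<^sub>1 \<le> c\<^sub>2"
    and alpha: "\<And>\<delta>. 0 < \<delta> \<Longrightarrow> \<delta> \<le> \<delta>max \<Longrightarrow> c\<^sub>1 * \<delta>\<^sup>2 \<le> \<alpha> \<delta> \<and> \<alpha> \<delta> \<le> c\<^sub>2 * \<delta>\<^sup>2"
  shows "scale_space ((normal_op A)\<inverse>) (chi \<Psi>) = Range (fun_calc (normal_op A) (psibar \<Psi>)) \<and>
    (\<exists>K>0. \<forall>g\<delta> :: real \<Rightarrow> 'y.
       (\<forall>\<delta>. 0 < \<delta> \<and> \<delta> \<le> \<delta>max \<longrightarrow> norm (g - g\<delta> \<delta>) \<le> \<delta>) \<longrightarrow>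
       (\<lambda>\<delta>. norm (f - regularised A G (\<alpha> \<delta>) (g\<delta> \<delta>)))
         \<in> O[at_right 0](\<lambda>\<delta>. \<delta> * sqrt (\<Psi> (K / \<delta>\<^sup>2))))"
proof -
  \<comment> \<open>An element of \<open>range G\<close> comes with pairs in
    \<open>fun_calc\<close>, and any such pair carries a resolution.\<close>
  obtain E where "spectral_resolution ((normal_op A)\<inverse>) E"
    using link by (fastforce simp: scale_space_def fun_calc_def)
  then interpret inverse_normal_resolution \<Psi> A E
    by (intro inverse_normal_resolution.intro concave_index.intro inverse_normal_resolution_axioms.intro A Psi)
  have "G v \<in> spectral_dom E (\<lambda>t. sqrt (chi \<Psi> t))" for v
    using link unfolding scale_space_eq by blast
  note range = this
  obtain C where C: "\<And>v. (\<integral>t. chi \<Psi> t \<partial>scalar_measure E (G v)) \<le> C * (norm v)\<^sup>2"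
    using form_bounded_of_range_subset[OF borel_measurable_chi chi_nonneg G(1) range] by blast
  \<comment> \<open>\<open>C\<close> may be negative; the maximum with 0 permits multiplying
    inequalities by it. As the parameter is at most \<open>c\<^sub>2 * \<delta>\<^sup>2\<close>, the
    energy will be bounded by \<open>M * \<delta>\<^sup>2\<close>.\<close>
  define C' where "C' = max C 0"
  define M where "M = 1 + c\<^sub>2 * (norm w)\<^sup>2"
  have M: "0 \<le> M" "0 \<le> C'" using constants by (auto simp: M_def C'_def)
  \<comment> \<open>The summands belong to the weak and the strong part; dividing the energy bound
    by \<open>c\<^sub>1 * \<delta>\<^sup>2\<close> produces \<open>M / c\<^sub>1\<close>.\<close>
  define D where "D = sqrt (M + C' * (M / c\<^sub>1))"
  have rate: "(\<lambda>\<delta>. norm (f - regularised A G (\<alpha> \<delta>) (g\<delta> \<delta>))) \<in> O[at_right 0](\<lambda>\<delta>. \<delta> * sqrt (\<Psi> (1 / \<delta>\<^sup>2)))"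
    if noise: "\<And>\<delta>. 0 < \<delta> \<Longrightarrow> \<delta> \<le> \<delta>max \<Longrightarrow> norm (g - g\<delta> \<delta>) \<le> \<delta>" for g\<delta> :: "real \<Rightarrow> 'y"
  proof (rule bigoI[where c = D])
    have "norm (norm (f - regularised A G (\<alpha> \<delta>) (g\<delta> \<delta>))) \<le> D * norm (\<delta> * sqrt (\<Psi> (1 / \<delta>\<^sup>2)))"
      if \<delta>: "0 < \<delta>" "\<delta> \<le> \<delta>max" for \<delta>
    proof -
      have al: "c\<^sub>1 * \<delta>\<^sup>2 \<le> \<alpha> \<delta>" "\<alpha> \<delta> \<le> c\<^sub>2 * \<delta>\<^sup>2" using alpha[OF \<delta>] by auto
      have "0 < c\<^sub>1 * \<delta>\<^sup>2" using constants \<delta> by simp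
      then have "0 < \<alpha> \<delta>" using al by linarith
      moreover have "norm (A (G w) - g\<delta> \<delta>) \<le> \<delta>" using noise[OF \<delta>] source by simp
      ultimately obtain e where e: "f - regularised A G (\<alpha> \<delta>) (g\<delta> \<delta>) = G e"
          and bound: "(norm (A (G e)))\<^sup>2 + \<alpha> \<delta> * (norm e)\<^sup>2 \<le> \<delta>\<^sup>2 + \<alpha> \<delta> * (norm w)\<^sup>2"
        using regularised_error[OF A(1) G(1,4)] source by blast
      have "\<alpha> \<delta> * (norm w)\<^sup>2 \<le> c\<^sub>2 * \<delta>\<^sup>2 * (norm w)\<^sup>2" using al by (intro mult_right_mono) auto
      then have total: "(norm (A (G e)))\<^sup>2 + \<alpha> \<delta> * (norm e)\<^sup>2 \<le> M * \<delta>\<^sup>2"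
        using bound by (simp add: M_def algebra_simps)
      moreover have "0 \<le> \<alpha> \<delta> * (norm e)\<^sup>2" using \<open>0 < \<alpha> \<delta>\<close> by simp
      ultimately have weak: "(norm (A (G e)))\<^sup>2 \<le> M * \<delta>\<^sup>2" by linarith
      have "c\<^sub>1 * \<delta>\<^sup>2 * (norm e)\<^sup>2 \<le> \<alpha> \<delta> * (norm e)\<^sup>2" using al by (intro mult_right_mono) auto
      also have "\<dots> \<le> M * \<delta>\<^sup>2" using total zero_le_power2[of "norm (A (G e))"] by linarith
      finally have strong: "(norm e)\<^sup>2 \<le> M / c\<^sub>1" using constants \<delta> by (simp add: field_simps)
      have "(\<integral>t. chi \<Psi> t \<partial>scalar_measure E (G e)) \<le> C' * (norm e)\<^sup>2"
        using C[of e] mult_right_mono[of C C' "(norm e)\<^sup>2"] by (simp add: C'_def)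
      also have "\<dots> \<le> C' * (M / c\<^sub>1)" using strong M by (intro mult_left_mono)
      finally have chi: "(\<integral>t. chi \<Psi> t \<partial>scalar_measure E (G e)) * \<delta>\<^sup>2 \<le> C' * (M / c\<^sub>1) * \<delta>\<^sup>2"
        by (rule mult_right_mono) simp
      have Psi_nonneg: "0 \<le> \<Psi> (1 / \<delta>\<^sup>2)" using Psi_pos[of "1 / \<delta>\<^sup>2"] \<delta> by simp
      \<comment> \<open>For \<open>s = 1 / \<delta>\<^sup>2\<close> the strong part is multiplied by
        \<open>\<delta>\<^sup>2\<close> and matches the order of the weak part.\<close>
      have "(norm (G e))\<^sup>2 \<le> \<Psi> (1 / \<delta>\<^sup>2) *
          ((norm (A (G e)))\<^sup>2 + (\<integral>t. chi \<Psi> t \<partial>scalar_measure E (G e)) / (1 / \<delta>\<^sup>2))"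
        using \<delta> by (intro norm_le_weak_strong range) simp
      also have "\<dots> \<le> \<Psi> (1 / \<delta>\<^sup>2) * (M * \<delta>\<^sup>2 + C' * (M / c\<^sub>1) * \<delta>\<^sup>2)"
        using weak chi Psi_nonneg by (intro mult_left_mono) auto
      also have "\<dots> = (M + C' * (M / c\<^sub>1)) * (\<delta>\<^sup>2 * \<Psi> (1 / \<delta>\<^sup>2))"
        by (simp add: algebra_simps)
      finally have "norm (G e) \<le> sqrt ((M + C' * (M / c\<^sub>1)) * (\<delta>\<^sup>2 * \<Psi> (1 / \<delta>\<^sup>2)))"
        by (rule real_le_rsqrt)
      also have "\<dots> = D * (\<delta> * sqrt (\<Psi> (1 / \<delta>\<^sup>2)))"
        using \<delta> by (simp add: D_def real_sqrt_mult)
      finally show ?thesis using \<delta> Psi_nonneg by (simp add: e abs_mult)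
    qed
    then show "\<forall>\<^sub>F \<delta> in at_right 0. norm (norm (f - regularised A G (\<alpha> \<delta>) (g\<delta> \<delta>)))
        \<le> D * norm (\<delta> * sqrt (\<Psi> (1 / \<delta>\<^sup>2)))"
      unfolding eventually_at_right[OF delta_max] using delta_max less_imp_le by blast
  qed
  have "\<exists>K>0. \<forall>g\<delta> :: real \<Rightarrow> 'y.
       (\<forall>\<delta>. 0 < \<delta> \<and> \<delta> \<le> \<delta>max \<longrightarrow> norm (g - g\<delta> \<delta>) \<le> \<delta>) \<longrightarrow>
       (\<lambda>\<delta>. norm (f - regularised A G (\<alpha> \<delta>) (g\<delta> \<delta>)))
         \<in> O[at_right 0](\<lambda>\<delta>. \<delta> * sqrt (\<Psi> (K / \<delta>\<^sup>2)))"
    \<comment> \<open>The choice \<open>s = 1 / \<delta>\<^sup>2\<close> corresponds to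
      \<open>K = 1\<close>.\<close>
    using rate by (intro exI[of _ 1]) simp
  then show ?thesis by (simp only: scale_space_eq Range_psibar_eq)
qed

end
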